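(* Suppose that $0<\alpha<\frac12$ and $k\le c\min\{p^{\gamma},\frac{n}{\log p}\}$ for some constants $c>0$ and $0\le\gamma<\frac12$. Let $k_1\le(1-\zeta_0)k-1$ for some constant $0<\zeta_0<1$. Then for any $\theta^*=(\beta^*,\mathrm{I},\sigma)\in\Theta(k_1)$, $$\inf_{\mathrm{CI}\in\mathcal{I}_\alpha(\Theta(k),\,\sum_{i=1}^p\beta_i)}\mathbb{E}_{\theta^*}L(\mathrm{CI})\ge c_1\,k\sqrt{\frac{\log p}{n}}\;\sigma$$ for some constant $c_1>0$.
   Context: Model: one observes $Z=(Z_1,\dots,Z_n)$ with $Z_i=(y_i,X_{i\cdot})\in\mathbb{R}^{p+1}$, $y=X\beta+\epsilon$, where $X\in\mathbb{R}^{n\times p}$ has i.i.d. rows $X_{i\cdot}\sim N_p(0,\Sigma)$, independent of $\epsilon\sim N_n(0,\sigma^2\mathrm{I})$; $\Sigma$ and $\sigma$ are unknown. Let $\Omega=\Sigma^{-1}$ and $\theta=(\beta,\Omega,\sigma)$; $\mathbb{P}_\theta,\mathbb{E}_\theta$ are the corresponding probability and expectation. $\mathrm{I}$ is the identity matrix. $\|x\|_0$ is the number of nonzero entries of $x$. Parameter space: $\Theta(k)=\{(\beta,\Omega,\sigma):\|\beta\|_0\le k,\ \frac1{M_1}\le\lambda_{\min}(\Omega)\le\lambda_{\max}(\Omega)\le M_1,\ 0<\sigma\le M_2\}$, where $M_1>1$ and $M_2>0$ are constants. Confidence intervals: for a parameter space $\Theta$ and functional $\mathrm{T}$ of $\beta$,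 $\mathcal{I}_\alpha(\Theta,\mathrm{T})$ is the set of all intervals $\mathrm{CI}=[l(Z),u(Z)]$ with $\inf_{\theta\in\Theta}\mathbb{P}_\theta(l(Z)\le\mathrm{T}(\beta)\le u(Z))\ge1-\alpha$; the length is $L(\mathrm{CI})=u(Z)-l(Z)$. *)

theory Defs
  imports
    "HOL-Probability.Distributions"
    "Jordan_Normal_Form.Char_Poly"
    "Jordan_Normal_Form.Gauss_Jordan_Elimination"
begin

unbundle no vec_syntax
hide_const (open) Finite_Cartesian_Product.vec Determinants.det Finite_Cartesian_Product.transpose
hide_type (open) Finite_Cartesian_Product.vec

text \<open>
  The constants of the main result must not depend on the dimensions, so dimensions are natural
  numbers rather than types. Parameters are vectors and matrices with explicit carriers; random
  vectors take values in the product measurable space over the index set \<open>{..<m}\<close>, and \<open>vec m x\<close>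
  turns such a function into a vector.
\<close>

definition mat_inv :: "real mat \<Rightarrow> real mat" where
  "mat_inv A = the (mat_inverse A)"

text \<open>The law $N_m(0,S)$; it is only meaningful for symmetric positive definite \<open>S\<close>.\<close>

definition mvn_density :: "nat \<Rightarrow> real mat \<Rightarrow> (nat \<Rightarrow> real) \<Rightarrow> real" where
  "mvn_density m S x =
     exp (- (vec m x \<bullet> (mat_inv S *\<^sub>v vec m x)) / 2) / sqrt ((2 * pi) ^ m * det S)"

definition mvn :: "nat \<Rightarrow> real mat \<Rightarrow> (nat \<Rightarrow> real) measure" where
  "mvn m S = density (Pi\<^sub>M {..<m} (\<lambda>_. lborel)) (\<lambda>x. ennreal (mvn_density m S x))"

type_synonym data = "nat \<Rightarrow> real \<times> (nat \<Rightarrow> real)"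
type_synonym param = "real vec \<times> real mat \<times> real"

definition data_space :: "nat \<Rightarrow> nat \<Rightarrow> data measure" where
  "data_space n p = Pi\<^sub>M {..<n} (\<lambda>_. borel \<Otimes>\<^sub>M Pi\<^sub>M {..<p} (\<lambda>_. borel))"

definition observe :: "nat \<Rightarrow> nat \<Rightarrow> real vec \<Rightarrow> (nat \<Rightarrow> nat \<Rightarrow> real) \<times> (nat \<Rightarrow> real) \<Rightarrow> data" where
  "observe n p \<beta> = (\<lambda>(X, \<epsilon>). \<lambda>i\<in>{..<n}. (vec p (X i) \<bullet> \<beta> + \<epsilon> i, X i))"

fun data_law :: "nat \<Rightarrow> nat \<Rightarrow> param \<Rightarrow> data measure" where
  "data_law n p (\<beta>, \<Omega>, \<sigma>) =
     distr (Pi\<^sub>M {..<n} (\<lambda>_. mvn p (mat_inv \<Omega>)) \<Otimes>\<^sub>M mvn n (\<sigma>\<^sup>2 \<cdot>\<^sub>m 1\<^sub>m n))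
       (data_space n p) (observe n p \<beta>)"

definition norm0 :: "real vec \<Rightarrow> nat" where
  "norm0 v = card {i. i < dim_vec v \<and> v $ i \<noteq> 0}"

definition lambda_min :: "real mat \<Rightarrow> real" where
  "lambda_min A = Min {e. eigenvalue A e}"

definition lambda_max :: "real mat \<Rightarrow> real" where
  "lambda_max A = Max {e. eigenvalue A e}"

text \<open>Precision matrices are symmetric, being inverses of covariance matrices.\<close>

definition param_space :: "nat \<Rightarrow> real \<Rightarrow> real \<Rightarrow> nat \<Rightarrow> param set" where
  "param_space p M1 M2 k =
     {(\<beta>, \<Omega>, \<sigma>). \<beta> \<in> carrier_vec p \<and> norm0 \<beta> \<le> k \<and>
        \<Omega> \<in> carrier_mat p p \<and> transpose_mat \<Omega> = \<Omega> \<and>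
        1 / M1 \<le> lambda_min \<Omega> \<and> lambda_min \<Omega> \<le> lambda_max \<Omega> \<and> lambda_max \<Omega> \<le> M1 \<and>
        0 < \<sigma> \<and> \<sigma> \<le> M2}"

text \<open>An interval is represented by its pair of endpoints \<open>(l, u)\<close> as functions of the data.\<close>

definition conf_intervals ::
  "nat \<Rightarrow> nat \<Rightarrow> real \<Rightarrow> param set \<Rightarrow> (real vec \<Rightarrow> real) \<Rightarrow> ((data \<Rightarrow> real) \<times> (data \<Rightarrow> real)) set" where
  "conf_intervals n p \<alpha> \<Theta> T =
     {(l, u). l \<in> borel_measurable (data_space n p) \<and> u \<in> borel_measurable (data_space n p) \<and>
        (\<forall>z\<in>space (data_space n p). l z \<le> u z) \<and>
        (INF \<theta>\<in>\<Theta>. measure (data_law n p \<theta>)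
           {z \<in> space (data_space n p). l z \<le> T (fst \<theta>) \<and> T (fst \<theta>) \<le> u z}) \<ge> 1 - \<alpha>}"

text \<open>The length is nonnegative, so its expectation always exists in $[0,\infty]$.\<close>

definition expected_length ::
  "nat \<Rightarrow> nat \<Rightarrow> param \<Rightarrow> (data \<Rightarrow> real) \<times> (data \<Rightarrow> real) \<Rightarrow> ennreal" where
  "expected_length n p \<theta> CI = (\<integral>\<^sup>+ z. ennreal (snd CI z - fst CI z) \<partial>data_law n p \<theta>)"

end

theory Submission
  imports Defs
begin

text \<open>
  The idea is to hide the parameter \<open>\<beta>\<close> among many sparse perturbations of it that move the target
  \<open>\<Sum>\<beta>\<^sub>i\<close> by a fixed amount but are, on average, hardly distinguishable from it. With \<open>m\<close> of order \<open>k\<close>,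
  every perturbation \<open>\<beta> + r 1\<^sub>A\<close> with \<open>card A = m\<close> stays \<open>k\<close>-sparse and shifts the sum by exactly \<open>m r\<close>,
  wherever the support \<open>A\<close> lies. An interval that covers with probability \<open>1 - \<alpha>\<close> over the whole parameter
  space covers the shifted sum under each perturbation, hence under their mixture. If the mixture is
  within \<open>t\<close> of the law at \<open>\<beta>\<close> in the chi-square sense, the interval covers both values of the sum with
  probability at least \<open>1 - 2\<alpha> - t\<close> under \<open>\<beta>\<close> itself, so its expected length is at least
  \<open>m r (1 - 2\<alpha> - t)\<close> (\<open>two_point_coverage_length\<close>). The scale \<open>r = \<sigma> \<surd>(h log p / n)\<close> with a small
  constant \<open>h\<close> gives the claimed rate.

  What makes the mixture indistinguishable for \<open>r\<close> of this size is that the noise variance of a perturbed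
  parameter is lowered from \<open>\<sigma>\<^sup>2\<close> to \<open>\<sigma>\<^sup>2 - m r\<^sup>2\<close>, so that the marginal variance of the responses does not
  change. The likelihood ratios of two supports \<open>A\<close> and \<open>B\<close> with respect to \<open>\<beta>\<close> then have, per
  observation, the inner product \<open>1 / (1 - card (A \<inter> B) r\<^sup>2 / \<sigma>\<^sup>2)\<close> (\<open>row_ratio_second_moment\<close>), which is
  \<open>1\<close> for disjoint supports. With unchanged noise the inner product would also depend on the product of
  the norms of the perturbations, which is too large when \<open>k\<close> is close to \<open>n / log p\<close>. Lowering \<open>\<sigma>\<close> is
  legitimate because the noise level is unknown and bounded only from above.

  The chi-square distance is therefore governed by the overlap of two random supports. Cut
  \<open>{..<m q}\<close> into \<open>m\<close> blocks of length \<open>q = p div m\<close> and let \<open>A\<close> contain one uniformly chosen coordinate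
  of each block. The overlap is then binomial, and its exponential moment is explicit
  (\<open>sum_exp_agreements\<close>): for an overlap \<open>J\<close>, the mean of \<open>exp (u J)\<close> is at most
  \<open>exp (m (e\<^sup>u - 1) / q)\<close>. For \<open>u = 2 h log p\<close> the exponent is of order \<open>p\<^sup>2\<^sup>\<gamma>\<^sup>-\<^sup>1 (p\<^sup>2\<^sup>h - 1)\<close>, and since
  \<open>2\<gamma> < 1\<close> this is at most a constant times \<open>h\<close>, uniformly in \<open>p \<ge> 1\<close> (\<open>powr_small_exponent_bound\<close>).
  So a single choice of \<open>h\<close> works for all dimensions.
\<close>

section \<open>Product densities and Gaussian vectors with scalar covariance\<close>

text \<open>
  On rectangles the density factorises, so both measures agree there.
\<close>

lemma PiM_density:
  fixes M :: "'i \<Rightarrow> 'a measure"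
  assumes "product_sigma_finite M" and I: "finite I"
    and f[measurable]: "\<And>i. f i \<in> borel_measurable (M i)"
    and sf: "product_sigma_finite (\<lambda>i. density (M i) (f i))"
  shows "density (Pi\<^sub>M I M) (\<lambda>x. \<Prod>i\<in>I. f i (x i)) = Pi\<^sub>M I (\<lambda>i. density (M i) (f i))"
proof (rule product_sigma_finite.PiM_eqI[OF sf I])
  interpret product_sigma_finite M by fact
  show "sets (density (Pi\<^sub>M I M) (\<lambda>x. \<Prod>i\<in>I. f i (x i))) = sets (Pi\<^sub>M I (\<lambda>i. density (M i) (f i)))"
    by (auto intro!: sets_PiM_cong)
  fix A assume A': "\<And>i. i \<in> I \<Longrightarrow> A i \<in> sets (density (M i) (f i))"
  then have A[measurable]: "\<And>i. i \<in> I \<Longrightarrow> A i \<in> sets (M i)" by simp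
  have ind: "(\<Prod>i\<in>I. f i (x i)) * indicator (Pi\<^sub>E I A) x = (\<Prod>i\<in>I. f i (x i) * indicator (A i) (x i))"
    if "x \<in> space (Pi\<^sub>M I M)" for x
  proof -
    have "indicator (Pi\<^sub>E I A) x = (\<Prod>i\<in>I. indicator (A i) (x i) :: ennreal)"
      using that I by (auto simp: indicator_def space_PiM PiE_iff Pi_iff prod_zero_iff)
    then show ?thesis by (simp add: prod.distrib)
  qed
  have "emeasure (density (Pi\<^sub>M I M) (\<lambda>x. \<Prod>i\<in>I. f i (x i))) (Pi\<^sub>E I A)
      = (\<integral>\<^sup>+x. (\<Prod>i\<in>I. f i (x i)) * indicator (Pi\<^sub>E I A) x \<partial>Pi\<^sub>M I M)"
    by (rule emeasure_density) (use A I in \<open>auto intro!: sets_PiM_I_finite\<close>)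
  also have "\<dots> = (\<integral>\<^sup>+x. (\<Prod>i\<in>I. f i (x i) * indicator (A i) (x i)) \<partial>Pi\<^sub>M I M)"
    by (rule nn_integral_cong) (rule ind)
  also have "\<dots> = (\<Prod>i\<in>I. \<integral>\<^sup>+x. f i x * indicator (A i) x \<partial>M i)"
    using I by (intro product_nn_integral_prod) auto
  also have "\<dots> = (\<Prod>i\<in>I. emeasure (density (M i) (f i)) (A i))"
    by (intro prod.cong refl emeasure_density[symmetric]) auto
  finally show "emeasure (density (Pi\<^sub>M I M) (\<lambda>x. \<Prod>i\<in>I. f i (x i))) (Pi\<^sub>E I A)
    = (\<Prod>i\<in>I. emeasure (density (M i) (f i)) (A i))" .
qed

lemma mat_inverse_scaled_one:
  fixes c :: real
  assumes "c \<noteq> 0"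
  shows "mat_inv (c \<cdot>\<^sub>m 1\<^sub>m n) = (1 / c) \<cdot>\<^sub>m 1\<^sub>m n"
proof -
  let ?A = "c \<cdot>\<^sub>m 1\<^sub>m n" and ?B = "(1 / c) \<cdot>\<^sub>m 1\<^sub>m n"
  have AB: "?A * ?B = 1\<^sub>m n" "?B * ?A = 1\<^sub>m n"
    using assms by (auto simp: mult_smult_distrib[of _ n n _ n] mult_smult_assoc_mat[of _ n n _ n]
        intro!: eq_matI)
  then have "?A \<in> Units (ring_mat TYPE(real) n ())"
    by (auto simp: Units_def ring_mat_def)
  then obtain C where C: "mat_inverse ?A = Some C"
    using mat_inverse(1)[of ?A n "()"] by (cases "mat_inverse ?A") auto
  then have "C = ?B"
    using mat_inverse(2)[of ?A n C] AB(1)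
      assoc_mult_mat[of C n n ?A n ?B n] by auto
  with C show ?thesis by (simp add: mat_inv_def)
qed

text \<open>
  With a scalar covariance matrix the exponent is a sum over the coordinates, so the joint density is a
  product of one-dimensional normal densities and the coordinates are independent.
\<close>

lemma mvn_scaled_identity:
  assumes s: "\<sigma> > 0"
  shows "mvn m (\<sigma>\<^sup>2 \<cdot>\<^sub>m 1\<^sub>m m) = Pi\<^sub>M {..<m} (\<lambda>_. density lborel (normal_density 0 \<sigma>))"
proof -
  have sq: "vec m x \<bullet> ((1 / \<sigma>\<^sup>2 \<cdot>\<^sub>m 1\<^sub>m m) *\<^sub>v vec m x) = (\<Sum>i<m. (x i)\<^sup>2) / \<sigma>\<^sup>2" for x :: "nat \<Rightarrow> real"
  proof -
    have "(1 / \<sigma>\<^sup>2 \<cdot>\<^sub>m 1\<^sub>m m) *\<^sub>v vec m x = (1 / \<sigma>\<^sup>2) \<cdot>\<^sub>v vec m x"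
      by (intro eq_vecI) auto
    then show ?thesis
      by (simp add: scalar_prod_def sum_divide_distrib power2_eq_square atLeast0LessThan)
  qed
  have dens: "mvn_density m (\<sigma>\<^sup>2 \<cdot>\<^sub>m 1\<^sub>m m) x = (\<Prod>i<m. normal_density 0 \<sigma> (x i))" for x
  proof -
    have "(\<Prod>i<m. normal_density 0 \<sigma> (x i)) = (1 / sqrt (2 * pi * \<sigma>\<^sup>2)) ^ m * exp (\<Sum>i<m.
        - (x i)\<^sup>2 / (2 * \<sigma>\<^sup>2))"
      by (simp add: normal_density_def prod_dividef exp_sum power_one_over)
    moreover have "sqrt ((2 * pi) ^ m * (\<sigma>\<^sup>2) ^ m) = sqrt (2 * pi * \<sigma>\<^sup>2) ^ m"
      by (metis power_mult_distrib real_sqrt_power)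
    moreover have "(\<Sum>i<m. - (x i)\<^sup>2 / (2 * \<sigma>\<^sup>2)) = - ((\<Sum>i<m. (x i)\<^sup>2) / \<sigma>\<^sup>2) / 2"
      by (simp add: sum_divide_distrib sum_negf mult.commute)
    moreover have "mvn_density m (\<sigma>\<^sup>2 \<cdot>\<^sub>m 1\<^sub>m m) x
        = exp (- ((\<Sum>i<m. (x i)\<^sup>2) / \<sigma>\<^sup>2) / 2) / sqrt ((2 * pi) ^ m * (\<sigma>\<^sup>2) ^ m)"
      unfolding mvn_density_def using s by (simp add: mat_inverse_scaled_one sq)
    ultimately show ?thesis by (simp add: power_one_over)
  qed
  have ps: "prob_space (density lborel (\<lambda>x. ennreal (normal_density 0 \<sigma> x)))"
    by (rule prob_space_normal_density[OF s])
  have "mvn m (\<sigma>\<^sup>2 \<cdot>\<^sub>m 1\<^sub>m m) = density (Pi\<^sub>M {..<m} (\<lambda>_. lborel)) (\<lambda>x. \<Prod>i<m. ennreal (normal_density 0 \<sigma>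
      (x i)))"
    by (simp add: mvn_def dens prod_ennreal)
  also have "\<dots> = Pi\<^sub>M {..<m} (\<lambda>_. density lborel (normal_density 0 \<sigma>))"
    by (rule PiM_density) (auto simp: product_sigma_finite_def prob_space_imp_sigma_finite[OF ps]
        sigma_finite_lborel)
  finally show ?thesis .
qed

section \<open>Gaussian integrals for one observation\<close>

abbreviation std_normal :: "real measure" where
  "std_normal \<equiv> density lborel std_normal_density"

text \<open>
  Gaussian densities are indexed by the variance, as adding independent terms adds variances.
\<close>

abbreviation gaussian_density :: "real \<Rightarrow> real \<Rightarrow> real" where
  "gaussian_density v \<equiv> normal_density 0 (sqrt v)"

lemma prob_space_std_normal: "prob_space std_normal"
  by (rule prob_space_normal_density) simp

lemma product_sigma_finite_std_normal: "product_sigma_finite (\<lambda>_. std_normal)"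
  by (simp add: product_sigma_finite_def prob_space_imp_sigma_finite prob_space_std_normal)

text \<open>
  Averaging a Gaussian density over a Gaussian shift is a convolution: the variances add.
\<close>

lemma gaussian_smoothing:
  assumes v: "v > 0" and r: "r > 0"
  shows "(\<integral>\<^sup>+t. ennreal (gaussian_density v (w - r * t)) \<partial>std_normal)
      = ennreal (gaussian_density (v + r\<^sup>2) w)"
proof -
  have *: "normal_density 0 r (r * t) = std_normal_density t / r" for t
    using r by (simp add: normal_density_def field_simps real_sqrt_mult)
  have "ennreal (gaussian_density (v + r\<^sup>2) w)
      = (\<integral>\<^sup>+y. ennreal (normal_density 0 (sqrt v) (w - y) * normal_density 0 r y) \<partial>lborel)"
    using conv_normal_density_zero_mean[of "sqrt v" r] v r by (simp add: fun_eq_iff)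
  also have "\<dots> = ennreal \<bar>r\<bar> * (\<integral>\<^sup>+t. ennreal (normal_density 0 (sqrt v) (w
      - (0 + r * t)) * normal_density 0 r (0 + r * t)) \<partial>lborel)"
    using r by (intro nn_integral_real_affine) auto
  also have "\<dots> = (\<integral>\<^sup>+t. ennreal \<bar>r\<bar> * ennreal (normal_density 0 (sqrt v) (w
      - (0 + r * t)) * normal_density 0 r (0 + r * t)) \<partial>lborel)"
    by (intro nn_integral_cmult[symmetric]) auto
  also have "\<dots> = (\<integral>\<^sup>+t. ennreal (std_normal_density t) * ennreal (gaussian_density v (w - r * t)) \<partial>lborel)"
    using r by (intro nn_integral_cong, simp only: add_0 *) (simp add: mult.commute flip: ennreal_mult)
  also have "\<dots> = (\<integral>\<^sup>+t. ennreal (gaussian_density v (w - r * t)) \<partial>std_normal)"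
    by (intro nn_integral_density[symmetric]) auto
  finally show ?thesis by simp
qed

text \<open>
  Coordinates outside \<open>A \<union> B\<close> integrate to one; each of the others shifts only one of the two factors and
  adds \<open>r\<^sup>2\<close> to its variance. Empty \<open>A\<close> or \<open>B\<close> are included, which treats the overlap and the rest of two
  supports without case distinctions.
\<close>

lemma gaussian_smoothing_disjoint:
  fixes r v v' w w' :: real
  assumes "finite I" and r: "r > 0"
  shows "\<lbrakk>A \<subseteq> I; B \<subseteq> I; A \<inter> B = {}; v > 0; v' > 0\<rbrakk> \<Longrightarrow>
    (\<integral>\<^sup>+x. ennreal (gaussian_density v (w - r * sum x A)) * ennreal (gaussian_density v' (w' - r * sum x B))
        \<partial>Pi\<^sub>M I (\<lambda>_. std_normal))
    = ennreal (gaussian_density (v + real (card A) * r\<^sup>2) w) * ennreal (gaussian_density (v'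
        + real (card B) * r\<^sup>2) w')"
  using \<open>finite I\<close>
proof (induction I arbitrary: A B w w')
  case empty
  then have "A = {}" and "B = {}" by simp_all
  then show ?case by (simp add: PiM_empty nn_integral_count_space_finite)
next
  case (insert i I)
  interpret product_sigma_finite "\<lambda>_::'a. std_normal" by (rule product_sigma_finite_std_normal)
  have fin: "finite A" "finite B" using insert.prems(1,2) \<open>finite I\<close> by (meson finite.insertI finite_subset)+
  have [measurable]: "(\<lambda>x. sum x A) \<in> borel_measurable (Pi\<^sub>M (insert i I) (\<lambda>_. std_normal))"
      if "A \<subseteq> insert i I" for A
    using that by (intro borel_measurable_sum) (auto intro!: measurable_component_singleton[THEN
        measurable_compose])
  let ?N = "\<lambda>v w. ennreal (gaussian_density v w)"
  have upd: "sum (x(i := t)) D = (if i \<in> D then t else 0) + sum x (D - {i})"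
      if "finite D" for x :: "'a \<Rightarrow> real" and t D
    using that by (auto simp: sum.remove intro!: sum.cong)
  have "(\<integral>\<^sup>+x. ?N v (w - r * sum x A) * ?N v' (w' - r * sum x B) \<partial>Pi\<^sub>M (insert i I) (\<lambda>_. std_normal))
      = (\<integral>\<^sup>+t. \<integral>\<^sup>+x. ?N v (w - r * sum (x(i := t)) A) * ?N v' (w' - r * sum (x(i := t)) B)
          \<partial>Pi\<^sub>M I (\<lambda>_. std_normal) \<partial>std_normal)"
    using insert.hyps insert.prems by (intro product_nn_integral_insert_rev) auto
  also have "\<dots> = (\<integral>\<^sup>+t. \<integral>\<^sup>+x. ?N v ((w - r * (if i \<in> A then t else 0)) - r * sum x (A
      - {i})) * ?N v' ((w' - r * (if i \<in> B then t else 0)) - r * sum x (B - {i}))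
      \<partial>Pi\<^sub>M I (\<lambda>_. std_normal) \<partial>std_normal)"
    using fin by (simp only: upd) (simp add: algebra_simps)
  also have "\<dots> = (\<integral>\<^sup>+t. ?N (v + real (card (A - {i})) * r\<^sup>2) (w
      - r * (if i \<in> A then t else 0)) * ?N (v' + real (card (B - {i})) * r\<^sup>2) (w'
      - r * (if i \<in> B then t else 0)) \<partial>std_normal)"
    using insert.prems by (intro nn_integral_cong insert.IH) auto
  also have "\<dots> = ?N (v + real (card A) * r\<^sup>2) w * ?N (v' + real (card B) * r\<^sup>2) w'"
  proof -
    have pos: "0 < v + real n * r\<^sup>2" "0 < v' + real n * r\<^sup>2" for n
      using insert.prems by (auto intro: add_pos_nonneg)
    have cardr: "v + real (card D - Suc 0) * r\<^sup>2 + r\<^sup>2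
        = v + real (card D) * r\<^sup>2" if "i \<in> D" "finite D" for v D
      using that card_gt_0_iff[of D] by (auto simp: of_nat_diff Suc_le_eq algebra_simps)
    consider "i \<in> A" "i \<notin> B" | "i \<notin> A" "i \<in> B" | "i \<notin> A" "i \<notin> B"
      using insert.prems by auto
    then show ?thesis
    proof cases
      case 1
      then show ?thesis using pos r fin
        by (simp add: nn_integral_multc gaussian_smoothing cardr[of A])
    next
      case 2
      then show ?thesis using pos r fin
        by (simp add: nn_integral_cmult gaussian_smoothing cardr[of B])
    next
      case 3
      then show ?thesis
        using prob_space.emeasure_space_1[OF prob_space_std_normal] by simp
    qed
  qed
  finally show ?case .
qed

text \<open>
  The square of a Gaussian density is proportional to the density of half the variance, which brings
  \<open>gaussian_smoothing\<close> back into play after two equal factors have appeared.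
\<close>

lemma gaussian_density_square:
  assumes "v > 0"
  shows "gaussian_density v x * gaussian_density v x = gaussian_density (v / 2) x / (2 * sqrt (pi * v))"
proof -
  have "exp (- x\<^sup>2 / (2 * v)) * exp (- x\<^sup>2 / (2 * v)) = exp (- x\<^sup>2 / (2 * (v / 2)))"
    by (simp flip: exp_add)
  moreover have "sqrt (2 * pi * v) * sqrt (2 * pi * v) = sqrt (2 * pi * (v / 2)) * (2 * sqrt (pi * v))"
    using assms by (simp add: real_sqrt_mult)
  ultimately show ?thesis
    using assms by (simp add: normal_density_def)
qed

text \<open>
  The quotient is again proportional to a Gaussian density, of variance \<open>\<omega> s / (s - \<omega>)\<close>; this needs the
  variance of the denominator to be the larger one.
\<close>

lemma gaussian_ratio_integral:
  assumes \<omega>: "0 < \<omega>" "\<omega> < s"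
  shows "(\<integral>\<^sup>+y. ennreal (gaussian_density \<omega> y / gaussian_density s y) \<partial>lborel)
    = ennreal (s * sqrt (2 * pi) / sqrt (s - \<omega>))"
proof -
  define \<kappa> where "\<kappa> = \<omega> * s / (s - \<omega>)"
  have \<kappa>: "\<kappa> > 0" using assms by (simp add: \<kappa>_def)
  have eq: "gaussian_density \<omega> y / gaussian_density s y
      = (s * sqrt (2 * pi) / sqrt (s - \<omega>)) * gaussian_density \<kappa> y" for y
  proof -
    have "exp (- y\<^sup>2 / (2 * \<omega>)) = exp (- y\<^sup>2 / (2 * \<kappa>)) * exp (- y\<^sup>2 / (2 * s))"
      using assms by (simp flip: exp_add) (simp add: \<kappa>_def field_simps)
    moreover have "sqrt \<kappa> = sqrt \<omega> * sqrt s / sqrt (s - \<omega>)"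
      by (simp add: \<kappa>_def real_sqrt_mult real_sqrt_divide)
    moreover have "s = sqrt s * sqrt s" using assms by simp
    ultimately show ?thesis
      using assms \<kappa> by (simp add: normal_density_def real_sqrt_mult field_simps)
  qed
  have "(\<integral>\<^sup>+y. ennreal (gaussian_density \<omega> y / gaussian_density s y) \<partial>lborel)
     = (\<integral>\<^sup>+y. ennreal (s * sqrt (2 * pi) / sqrt (s - \<omega>)) * ennreal (gaussian_density \<kappa> y) \<partial>lborel)"
    using assms by (intro nn_integral_cong, subst eq, intro ennreal_mult) auto
  also have "\<dots> = ennreal (s * sqrt (2 * pi) / sqrt (s - \<omega>)) * (\<integral>\<^sup>+y. ennreal (gaussian_density \<kappa> y) \<partial>lborel)"
    by (intro nn_integral_cmult) auto
  also have "(\<integral>\<^sup>+y. ennreal (gaussian_density \<kappa> y) \<partial>lborel) = 1"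
    using \<kappa> by (subst nn_integral_eq_integral) (auto simp: integral_normal_density)
  finally show ?thesis by simp
qed

text \<open>
  This is the inner product of two likelihood ratios for one observation, after centring the response.
  Fix the response \<open>y\<close> and integrate over the covariates first. Those in \<open>A - B\<close> and \<open>B - A\<close> each enter
  one factor only and raise its variance from \<open>\<tau>\<close> to the common value \<open>v = s - card (A \<inter> B) r\<^sup>2\<close>, since
  \<open>\<tau> = s - m r\<^sup>2\<close>. What remains is the square of one density shifted by the covariates in \<open>A \<inter> B\<close>, hence
  again a smoothing; the final integral over \<open>y\<close> is a ratio of Gaussian densities with constant \<open>s / v\<close>.
\<close>

lemma row_kernel_integral:
  fixes I A B :: "'i set" and r s :: real and m :: nat
  assumes I: "finite I" "A \<subseteq> I" "B \<subseteq> I" and card: "card A = m" "card B = m"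
    and r: "r > 0" and m: "real m * r\<^sup>2 < s"
  defines "\<tau> \<equiv> s - real m * r\<^sup>2"
  shows "(\<integral>\<^sup>+x. \<integral>\<^sup>+y. ennreal (gaussian_density \<tau> (y - r * sum x A) * gaussian_density \<tau> (y
      - r * sum x B) / gaussian_density s y)
      \<partial>lborel \<partial>Pi\<^sub>M I (\<lambda>_. std_normal)) = ennreal (1 / (1 - real (card (A \<inter> B)) * r\<^sup>2 / s))"
proof -
  interpret product_sigma_finite "\<lambda>_::'i. std_normal" by (rule product_sigma_finite_std_normal)
  let ?P = "\<lambda>I. Pi\<^sub>M I (\<lambda>_::'i. std_normal)"
  let ?N = "\<lambda>v w. ennreal (gaussian_density v w)"
  define C where "C = A \<inter> B"
  define D where "D = I - C"
  define v where "v = s - real (card C) * r\<^sup>2"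
  have CD: "I = C \<union> D" "C \<inter> D = {}" "finite C" "finite D" "finite A" "finite B"
    using I by (auto simp: C_def D_def intro: finite_subset)
  have "card C \<le> m" using CD card card_mono[of A C] by (auto simp: C_def)
  then have "real (card C) * r\<^sup>2 \<le> real m * r\<^sup>2" by (intro mult_right_mono) auto
  then have v: "v > 0" "v \<ge> \<tau>" using m by (auto simp: v_def \<tau>_def)
  have \<tau>: "\<tau> > 0" using m by (simp add: \<tau>_def)
  have s: "s > 0" using m r by (meson le_less_trans mult_nonneg_nonneg of_nat_0_le_iff zero_le_power2)
  have cA: "card (A - C) = m - card C" and cB: "card (B - C) = m - card C"
    using card CD by (auto simp: C_def card_Diff_subset)
  have vv: "\<tau> + real (m - card C) * r\<^sup>2 = v"
    using \<open>card C \<le> m\<close> by (simp add: \<tau>_def v_def of_nat_diff algebra_simps)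
  have half: "s - (v / 2 + real (card C) * r\<^sup>2) = v / 2"
    by (simp add: v_def field_simps)
  then have \<omega>: "0 < v / 2 + real (card C) * r\<^sup>2" "v / 2 + real (card C) * r\<^sup>2 < s"
    using v by (auto intro: add_pos_nonneg)
  have [measurable]: "(\<lambda>x. sum x S) \<in> borel_measurable (?P J)" if "S \<subseteq> J" for S J
    using that by (intro borel_measurable_sum) (auto intro!: measurable_component_singleton[THEN
        measurable_compose])
  interpret PI: prob_space "?P I" by (rule prob_space_PiM) (rule prob_space_std_normal)
  interpret pair_sigma_finite "?P I" lborel
    by (intro pair_sigma_finite.intro PI.sigma_finite_measure_axioms sigma_finite_lborel)
  have inner: "(\<integral>\<^sup>+x. ?N \<tau> (y - r * sum x A) * ?N \<tau> (y - r * sum x B) \<partial>?P I)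
      = ennreal (1 / (2 * sqrt (pi * v))) * ?N (v / 2 + real (card C) * r\<^sup>2) y" for y
  proof -
    have "(\<integral>\<^sup>+x. ?N \<tau> (y - r * sum x A) * ?N \<tau> (y - r * sum x B) \<partial>?P I)
       = (\<integral>\<^sup>+a. \<integral>\<^sup>+b. ?N \<tau> (y - r * sum (merge C D (a, b)) A) * ?N \<tau> (y - r * sum (merge C D (a, b)) B)
           \<partial>?P D \<partial>?P C)"
      using CD I by (subst CD(1), intro product_nn_integral_fold) auto
    also have "\<dots> = (\<integral>\<^sup>+a. \<integral>\<^sup>+b. ?N \<tau> ((y - r * sum a C) - r * sum b (A - C)) * ?N \<tau> ((y - r * sum a C)
        - r * sum b (B - C)) \<partial>?P D \<partial>?P C)"
    proof -
      have "y - r * sum (merge C D (a, b)) S = (y - r * sum a C) - r * sum b (S - C)"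
        if "C \<subseteq> S" "S \<subseteq> I" for a b :: "'i \<Rightarrow> real" and S
      proof -
        have "finite S" using that I by (auto intro: finite_subset)
        then have "sum (merge C D (a, b)) S = sum (merge C D (a, b)) (S - C) + sum (merge C D (a, b)) C"
          using that by (intro sum.subset_diff) auto
        moreover have "sum (merge C D (a, b)) (S - C) = sum b (S - C)" "sum (merge C D (a, b)) C = sum a C"
          using that CD(1) by (auto simp: merge_def intro!: sum.cong)
        ultimately show ?thesis by (simp add: algebra_simps)
      qed
      moreover have "C \<subseteq> A" "C \<subseteq> B" by (auto simp: C_def)
      ultimately show ?thesis
        using I by (simp only:)
    qed
    also have "\<dots> = (\<integral>\<^sup>+a. ?N v (y - r * sum a C) * ?N v (y - r * sum a C) \<partial>?P C)"
    proof (intro nn_integral_cong)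
      fix a
      have "A - C \<subseteq> D" "B - C \<subseteq> D" "(A - C) \<inter> (B - C) = {}"
        using I by (auto simp: C_def D_def)
      from gaussian_smoothing_disjoint[OF CD(4) r this \<tau> \<tau>, of "y - r * sum a C" "y - r * sum a C"]
      show "(\<integral>\<^sup>+b. ?N \<tau> ((y - r * sum a C) - r * sum b (A - C)) * ?N \<tau> ((y - r * sum a C) - r * sum b (B
          - C)) \<partial>?P D)
          = ?N v (y - r * sum a C) * ?N v (y - r * sum a C)"
        unfolding cA cB vv .
    qed
    \<comment> \<open>The factor \<open>?N 1 0 * sqrt (2 * pi)\<close> is one; it brings the integrand into the two-factor form of
      \<open>gaussian_smoothing_disjoint\<close> with an empty second set.\<close>
    also have "\<dots> = (\<integral>\<^sup>+a. ennreal (1 / (2 * sqrt (pi * v))) * (?N (v / 2) (y - r * sum a C) * ?N 1 (0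
        - r * sum a {}) * ennreal (sqrt (2 * pi))) \<partial>?P C)"
      using v by (intro nn_integral_cong) (simp add: ennreal_mult[symmetric] gaussian_density_square
          std_normal_density_def)
    also have "\<dots> = ennreal (1 / (2 * sqrt (pi * v))) * ((\<integral>\<^sup>+a. ?N (v / 2) (y - r * sum a C) * ?N 1 (0
        - r * sum a {}) \<partial>?P C) * ennreal (sqrt (2 * pi)))"
      by (simp add: nn_integral_cmult nn_integral_multc)
    also have "(\<integral>\<^sup>+a. ?N (v / 2) (y - r * sum a C) * ?N 1 (0 - r * sum a {}) \<partial>?P C)
        = ?N (v / 2 + real (card C) * r\<^sup>2) y * ?N (1 + real (card ({}::'i set)) * r\<^sup>2) 0"
      using CD r v by (intro gaussian_smoothing_disjoint) auto
    also have "\<dots> * ennreal (sqrt (2 * pi)) = ?N (v / 2 + real (card C) * r\<^sup>2) y"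
      by (simp add: ennreal_mult[symmetric] std_normal_density_def)
    finally show ?thesis .
  qed
  have "(\<integral>\<^sup>+x. \<integral>\<^sup>+y. ennreal (gaussian_density \<tau> (y - r * sum x A) * gaussian_density \<tau> (y
      - r * sum x B) / gaussian_density s y) \<partial>lborel \<partial>?P I)
    = (\<integral>\<^sup>+y. \<integral>\<^sup>+x. ennreal (gaussian_density \<tau> (y - r * sum x A) * gaussian_density \<tau> (y
        - r * sum x B) / gaussian_density s y) \<partial>?P I \<partial>lborel)"
    using I by (intro Fubini'[symmetric]) (simp add: split_beta')
  also have "\<dots> = (\<integral>\<^sup>+y. \<integral>\<^sup>+x. ennreal (1 / gaussian_density s y) * (?N \<tau> (y - r * sum x A) * ?N \<tau> (y
      - r * sum x B)) \<partial>?P I \<partial>lborel)"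
    by (intro nn_integral_cong) (simp add: ennreal_mult[symmetric])
  also have "\<dots> = (\<integral>\<^sup>+y. ennreal (1 / gaussian_density s y) * (ennreal (1 / (2 * sqrt (pi * v))) * ?N (v
      / 2 + real (card C) * r\<^sup>2) y) \<partial>lborel)"
    using I by (subst inner[symmetric]) (simp add: nn_integral_cmult)
  also have "\<dots> = (\<integral>\<^sup>+y. ennreal (1 / (2 * sqrt (pi * v))) * ennreal (gaussian_density (v / 2
      + real (card C) * r\<^sup>2) y / gaussian_density s y) \<partial>lborel)"
    using v by (intro nn_integral_cong) (simp add: ennreal_mult[symmetric])
  also have "\<dots> = ennreal (1 / (2 * sqrt (pi * v))) * ennreal (s * sqrt (2 * pi) / sqrt (s
      - (v / 2 + real (card C) * r\<^sup>2)))"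
    using half \<omega> by (subst nn_integral_cmult) (auto simp: gaussian_ratio_integral)
  also have "\<dots> = ennreal (1 / (2 * sqrt (pi * v)) * (s * sqrt (2 * pi) / sqrt (v / 2)))"
    using v s unfolding half by (intro ennreal_mult[symmetric]) auto
  also have "1 / (2 * sqrt (pi * v)) * (s * sqrt (2 * pi) / sqrt (v / 2)) = s / v"
    using v by (simp add: real_sqrt_mult real_sqrt_divide field_simps)
  also have "s / v = 1 / (1 - real (card C) * r\<^sup>2 / s)"
    using s v by (simp add: v_def field_simps)
  finally show ?thesis by (simp add: C_def)
qed

section \<open>Mixtures, chi-square distance and confidence intervals\<close>

text \<open>
  Let \<open>m\<close> be the density of the uniform mixture of the laws with densities \<open>L s\<close>. The second moments bound
  \<open>E (m - 1)\<^sup>2\<close> by \<open>t\<^sup>2\<close>, and the probability of \<open>A\<close> under the mixture exceeds the one under \<open>M\<close> by at most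
  \<open>E \<bar>m - 1\<bar>\<close>, which is at most \<open>t\<close>.
\<close>

lemma (in prob_space) chi_square_mixture_bound:
  fixes L :: "'s \<Rightarrow> 'a \<Rightarrow> real"
  assumes F: "finite F" "F \<noteq> {}" and t: "t > 0"
    and L[measurable]: "\<And>s. s \<in> F \<Longrightarrow> L s \<in> borel_measurable M" and nn: "\<And>s x. s \<in> F \<Longrightarrow> L s x \<ge> 0"
    and Q: "\<And>s. s \<in> F \<Longrightarrow> prob_space (density M (L s))"
    and second: "(\<Sum>s\<in>F. \<Sum>s'\<in>F. \<integral>\<^sup>+x. ennreal (L s x * L s' x) \<partial>M) \<le> ennreal ((1 + t\<^sup>2) * (real (card F))\<^sup>2)"
    and A[measurable]: "A \<in> sets M"
  shows "(\<Sum>s\<in>F. measure (density M (L s)) A) \<le> card F * (prob A + t)"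
proof -
  define N where "N = real (card F)"
  have N: "N > 0" using F by (simp add: N_def card_gt_0_iff)
  define m where "m x = (\<Sum>s\<in>F. L s x) / N" for x
  have [measurable]: "m \<in> borel_measurable M" unfolding m_def by measurable
  have m0: "m x \<ge> 0" for x using nn N by (auto simp: m_def intro!: divide_nonneg_pos sum_nonneg)
  have L1: "integrable M (L s)" and EL: "expectation (L s) = 1"
    and ELA: "expectation (\<lambda>x. L s x * indicator A x) = measure (density M (L s)) A" if "s \<in> F" for s
  proof -
    interpret Q: prob_space "density M (L s)" by (rule Q[OF that])
    have "(\<integral>\<^sup>+x. ennreal (L s x) \<partial>M) = 1"
      using Q.emeasure_space_1 that by (simp add: emeasure_density)
    then show "integrable M (L s)" "expectation (L s) = 1"
      using that nn by (auto intro!: integrableI_nonneg integral_eq_nn_integral simp: integral_eq_nn_integral)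
    have "emeasure (density M (L s)) A = (\<integral>\<^sup>+x. ennreal (L s x * indicator A x) \<partial>M)"
      using that by (subst emeasure_density) (auto intro!: nn_integral_cong simp: indicator_def)
    then show "expectation (\<lambda>x. L s x * indicator A x) = measure (density M (L s)) A"
      using that nn by (subst integral_eq_nn_integral) (auto simp: measure_def)
  qed
  have m1: "integrable M m" unfolding m_def using L1 by auto
  have Em: "expectation m = 1"
    unfolding m_def using L1 EL N by (simp add: N_def)
  have EmA: "expectation (\<lambda>x. m x * indicator A x) = (\<Sum>s\<in>F. measure (density M (L s)) A) / N"
    using L1 ELA by (simp add: m_def sum_distrib_right integrable_real_mult_indicator cong: sum.cong)
  have "(\<integral>\<^sup>+x. ennreal ((m x)\<^sup>2) \<partial>M) = (\<integral>\<^sup>+x. ennreal (1 / N\<^sup>2) * (\<Sum>s\<in>F. \<Sum>s'\<in>F. ennreal (L s x * L s' x)) \<partial>M)"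
  proof (intro nn_integral_cong)
    fix x
    have "(m x)\<^sup>2 = 1 / N\<^sup>2 * (\<Sum>s\<in>F. \<Sum>s'\<in>F. L s x * L s' x)"
      by (simp add: m_def power2_eq_square sum_product)
    moreover have "(\<Sum>s\<in>F. \<Sum>s'\<in>F. ennreal (L s x * L s' x)) = ennreal (\<Sum>s\<in>F. \<Sum>s'\<in>F. L s x * L s' x)"
      using nn by (simp add: sum_nonneg)
    ultimately show "ennreal ((m x)\<^sup>2) = ennreal (1 / N\<^sup>2) * (\<Sum>s\<in>F. \<Sum>s'\<in>F. ennreal (L s x * L s' x))"
      by (simp only: ennreal_mult'[of "1 / N\<^sup>2"] zero_le_divide_1_iff zero_le_power2)
  qed
  also have "\<dots> = ennreal (1 / N\<^sup>2) * (\<Sum>s\<in>F. \<Sum>s'\<in>F. \<integral>\<^sup>+x. ennreal (L s x * L s' x) \<partial>M)"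
    by (simp add: nn_integral_cmult nn_integral_sum)
  also have "\<dots> \<le> ennreal (1 / N\<^sup>2) * ennreal ((1 + t\<^sup>2) * N\<^sup>2)"
    using second by (intro mult_left_mono) (auto simp: N_def)
  also have "\<dots> = ennreal (1 + t\<^sup>2)"
    using N by (simp add: ennreal_mult'[symmetric])
  finally have sq: "(\<integral>\<^sup>+x. ennreal ((m x)\<^sup>2) \<partial>M) \<le> ennreal (1 + t\<^sup>2)" .
  then have m2: "integrable M (\<lambda>x. (m x)\<^sup>2)"
    by (intro integrableI_bounded) (auto simp: less_top[symmetric] top_unique elim: order_le_less_trans)
  have Em2: "expectation (\<lambda>x. (m x)\<^sup>2) \<le> 1 + t\<^sup>2"
    using sq by (subst integral_eq_nn_integral) (auto intro!: enn2real_leI)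
  have iI: "integrable M (indicator A :: 'a \<Rightarrow> real)"
    by (simp add: integrable_indicator_iff emeasure_eq_measure)
  have iA: "integrable M (\<lambda>x. m x * indicator A x)"
    using m1 by (intro integrable_real_mult_indicator) auto
  have "expectation (\<lambda>x. m x * indicator A x) - prob A
      = expectation (\<lambda>x. m x * indicator A x - indicator A x)"
    using iI iA by simp
  also have "\<dots> \<le> expectation (\<lambda>x. t / 2 + ((m x)\<^sup>2 - 2 * m x + 1) / (2 * t))"
  proof (rule integral_mono)
    fix x
    \<comment> \<open>The inequality of arithmetic and geometric means replaces Cauchy-Schwarz for \<open>E \<bar>m - 1\<bar>\<close>.\<close>
    have amgm: "\<bar>a\<bar> \<le> t / 2 + a\<^sup>2 / (2 * t)" for a
    proof -
      have "0 \<le> (\<bar>a\<bar> - t)\<^sup>2" by simp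
      then have "2 * t * \<bar>a\<bar> \<le> t\<^sup>2 + a\<^sup>2" by (simp add: power2_diff algebra_simps)
      then show ?thesis using t by (simp add: field_simps power2_eq_square)
    qed
    have "m x * indicator A x - indicator A x \<le> \<bar>m x - 1\<bar>" by (auto simp: indicator_def)
    also have "\<dots> \<le> t / 2 + ((m x)\<^sup>2 - 2 * m x + 1) / (2 * t)"
      using amgm[of "m x - 1"] by (simp add: power2_diff algebra_simps)
    finally show "m x * indicator A x - indicator A x \<le> t / 2 + ((m x)\<^sup>2 - 2 * m x + 1) / (2 * t)" .
  qed (use m1 m2 iI iA in auto)
  also have "\<dots> = t / 2 + (expectation (\<lambda>x. (m x)\<^sup>2) - 2 * expectation m + 1) / (2 * t)"
    using m1 m2 by (simp add: prob_space)
  also have "\<dots> \<le> t / 2 + t\<^sup>2 / (2 * t)"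
    using Em2 Em t by (intro add_left_mono divide_right_mono) auto
  also have "\<dots> = t" using t by (simp add: power2_eq_square)
  finally have "(\<Sum>s\<in>F. measure (density M (L s)) A) / N \<le> prob A + t"
    by (simp add: EmA)
  then show ?thesis using N by (simp add: N_def field_simps)
qed

text \<open>
  On the event that the interval contains both points, which has probability at least \<open>p + q - 1\<close>, its
  length is at least their distance.
\<close>

lemma (in prob_space) two_point_coverage_length:
  fixes l u :: "'a \<Rightarrow> real"
  assumes [measurable]: "l \<in> borel_measurable M" "u \<in> borel_measurable M"
    and lu: "\<And>z. z \<in> space M \<Longrightarrow> l z \<le> u z" and d: "d \<ge> 0"
    and a: "prob {z \<in> space M. l z \<le> a \<and> a \<le> u z} \<ge> p"
    and b: "prob {z \<in> space M. l z \<le> a + d \<and> a + d \<le> u z} \<ge> q"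
  shows "ennreal (d * (p + q - 1)) \<le> (\<integral>\<^sup>+z. ennreal (u z - l z) \<partial>M)"
proof -
  let ?A = "{z \<in> space M. l z \<le> a \<and> a \<le> u z}" and ?B = "{z \<in> space M. l z \<le> a + d \<and> a + d \<le> u z}"
  have "prob (?A \<union> ?B) \<le> 1" by (rule prob_le_1)
  moreover have "prob (?A \<union> ?B) = prob ?A + prob ?B - prob (?A \<inter> ?B)"
    using finite_measure_Union'[of ?A ?B] finite_measure_Diff'[of ?B ?A] by (simp add: Int_commute)
  ultimately have "p + q - 1 \<le> prob (?A \<inter> ?B)" using a b by linarith
  then have "ennreal (d * (p + q - 1)) \<le> ennreal (d * prob (?A \<inter> ?B))"
    using d by (intro ennreal_leI mult_left_mono)
  also have "\<dots> = (\<integral>\<^sup>+z. ennreal d * indicator (?A \<inter> ?B) z \<partial>M)"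
    using d by (subst nn_integral_cmult_indicator) (auto simp: ennreal_mult emeasure_eq_measure)
  also have "\<dots> \<le> (\<integral>\<^sup>+z. ennreal (u z - l z) \<partial>M)"
    by (intro nn_integral_mono) (auto simp: indicator_def intro!: ennreal_leI)
  finally show ?thesis .
qed

text \<open>
  Two independent uniform functions agree at each argument with probability \<open>1 / q\<close>, independently, so
  the number of agreements is binomial; its moment generating function is estimated by \<open>1 + x \<le> exp x\<close>.
\<close>

lemma sum_exp_agreements:
  fixes c :: real and m q :: nat
  assumes q: "q > 0"
  defines "F \<equiv> Pi\<^sub>E {..<m} (\<lambda>_. {..<q})"
  shows "(\<Sum>s\<in>F. \<Sum>s'\<in>F. exp (c * card {a. a < m \<and> s a = s' a}))
    \<le> exp (m * (exp c - 1) / q) * (real (card F))\<^sup>2"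
proof -
  have card: "real (card F) = real q ^ m" by (simp add: F_def card_PiE)
  have "(\<Sum>s'\<in>F. exp (c * card {a. a < m \<and> s a = s' a})) = (real q + exp c - 1) ^ m" if "s \<in> F" for s
  proof -
    have "exp (c * card {a. a < m \<and> s a = s' a}) = (\<Prod>a<m. if s a = s' a then exp c else 1)" for s'
    proof -
      have "{a. a < m \<and> s a = s' a} = {a \<in> {..<m}. s a = s' a}" by auto
      then show ?thesis
        by (simp add: prod.If_cases exp_of_nat_mult[symmetric] mult.commute Int_def)
    qed
    then have "(\<Sum>s'\<in>F. exp (c * card {a. a < m \<and> s a = s' a}))
        = (\<Prod>a<m. \<Sum>b<q. if s a = b then exp c else 1)"
      by (simp add: F_def prod_sum_PiE)
    also have "\<dots> = (\<Prod>a<m. real q + exp c - 1)"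
    proof (rule prod.cong[OF refl])
      fix a assume "a \<in> {..<m}"
      then have "s a \<in> {..<q}" using that by (auto simp: F_def)
      then have "(\<Sum>b<q. if s a = b then exp c else 1) = exp c + (\<Sum>b\<in>{..<q} - {s a}. 1)"
        by (subst sum.remove[of _ "s a"]) (auto intro!: sum.cong)
      also have "\<dots> = real q + exp c - 1"
        using \<open>s a \<in> {..<q}\<close> q by (simp add: of_nat_diff)
      finally show "(\<Sum>b<q. if s a = b then exp c else 1) = real q + exp c - 1" .
    qed
    finally show ?thesis by simp
  qed
  then have "(\<Sum>s\<in>F. \<Sum>s'\<in>F. exp (c * card {a. a < m \<and> s a = s' a})) = real q ^ m * (real q + exp c - 1) ^ m"
    by (simp add: card)
  also have "real q + exp c - 1 = real q * (1 + (exp c - 1) / q)"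
    using q by (simp add: field_simps)
  also have "real q ^ m * (real q * (1 + (exp c - 1) / q)) ^ m = (real q ^ m)\<^sup>2 * (1 + (exp c - 1) / q) ^ m"
    by (simp add: power_mult_distrib power2_eq_square)
  also have "\<dots> \<le> (real q ^ m)\<^sup>2 * exp ((exp c - 1) / q) ^ m"
  proof (intro mult_left_mono power_mono exp_ge_add_one_self)
    have "1 + 0 \<le> real q + exp c" using q by (intro add_mono) auto
    then have "- 1 \<le> (exp c - 1) / q" using q by (simp add: field_simps)
    then show "0 \<le> 1 + (exp c - 1) / q" by simp
  qed simp
  also have "exp ((exp c - 1) / q) ^ m = exp (m * (exp c - 1) / q)"
    by (simp add: exp_of_nat_mult[symmetric])
  finally show ?thesis by (simp add: card mult.commute)
qed

section \<open>The data as independent observations\<close>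

abbreviation row_space :: "nat \<Rightarrow> (real \<times> (nat \<Rightarrow> real)) measure" where
  "row_space p \<equiv> borel \<Otimes>\<^sub>M Pi\<^sub>M {..<p} (\<lambda>_. borel)"

abbreviation design_law :: "nat \<Rightarrow> (nat \<Rightarrow> real) measure" where
  "design_law p \<equiv> Pi\<^sub>M {..<p} (\<lambda>_. std_normal)"

definition linear_predictor :: "nat \<Rightarrow> real vec \<Rightarrow> (nat \<Rightarrow> real) \<Rightarrow> real" where
  "linear_predictor p \<beta> x = (\<Sum>j<p. x j * \<beta> $ j)"

text \<open>
  The law of one observation \<open>(y\<^sub>i, X\<^sub>i)\<close> when the covariates are standard normal.
\<close>

definition row_law :: "nat \<Rightarrow> real vec \<Rightarrow> real \<Rightarrow> (real \<times> (nat \<Rightarrow> real)) measure" where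
  "row_law p \<beta> \<sigma> = distr (design_law p \<Otimes>\<^sub>M density lborel (normal_density 0 \<sigma>)) (row_space p)
     (\<lambda>(x, e). (linear_predictor p \<beta> x + e, x))"

lemma borel_measurable_linear_predictor[measurable]:
  assumes "sets M = sets (Pi\<^sub>M {..<p} (\<lambda>_. borel))"
  shows "linear_predictor p \<beta> \<in> borel_measurable M"
proof -
  have "linear_predictor p \<beta> \<in> borel_measurable (Pi\<^sub>M {..<p} (\<lambda>_. borel))"
    unfolding linear_predictor_def[abs_def] by measurable
  then show ?thesis using measurable_cong_sets[OF assms refl, of borel] by blast
qed

lemma sets_design_law: "sets (design_law p) = sets (Pi\<^sub>M {..<p} (\<lambda>_. borel))"
  by (auto intro!: sets_PiM_cong)

lemma prob_space_design_law: "prob_space (design_law p)"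
  by (rule prob_space_PiM) (rule prob_space_std_normal)

lemma measurable_row_map:
  "(\<lambda>(x, e). (linear_predictor p \<beta> x + e, x)) \<in> design_law p \<Otimes>\<^sub>M density lborel (normal_density 0 \<sigma>) \<rightarrow>\<^sub>M
      row_space p"
proof -
  have "(\<lambda>(x, e). (linear_predictor p \<beta> x + e, x)) \<in> Pi\<^sub>M {..<p} (\<lambda>_. borel) \<Otimes>\<^sub>M borel \<rightarrow>\<^sub>M row_space p"
    by measurable
  moreover have "sets (design_law p \<Otimes>\<^sub>M density lborel (normal_density 0 \<sigma>))
      = sets (Pi\<^sub>M {..<p} (\<lambda>_. borel) \<Otimes>\<^sub>M borel)"
    by (intro sets_pair_measure_cong sets_design_law) simp
  ultimately show ?thesis using measurable_cong_sets by blast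
qed

lemma prob_space_row_law: "\<sigma> > 0 \<Longrightarrow> prob_space (row_law p \<beta> \<sigma>)"
  unfolding row_law_def
  by (intro prob_space.prob_space_distr measurable_row_map prob_space_pair prob_space_design_law
      prob_space_normal_density)

lemma sets_row_law[measurable_cong]: "sets (row_law p \<beta> \<sigma>) = sets (row_space p)"
  by (simp add: row_law_def)

text \<open>
  Given the covariates, the response has a Gaussian density centred at the linear predictor; translation
  invariance of Lebesgue measure moves the shift from the integrand into that density.
\<close>

lemma nn_integral_row_law:
  assumes \<sigma>: "\<sigma> > 0" and f[measurable]: "f \<in> borel_measurable (row_space p)"
  shows "(\<integral>\<^sup>+z. f z \<partial>row_law p \<beta> \<sigma>)
    = (\<integral>\<^sup>+x. \<integral>\<^sup>+y. f (y, x) * ennreal (normal_density 0 \<sigma> (y - linear_predictor p \<beta> x)) \<partial>lborel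
        \<partial>design_law p)"
proof -
  let ?N = "density lborel (normal_density 0 \<sigma>)"
  interpret N: prob_space ?N using \<sigma> by (rule prob_space_normal_density)
  have "(\<integral>\<^sup>+z. f z \<partial>row_law p \<beta> \<sigma>) = (\<integral>\<^sup>+xe. f (linear_predictor p \<beta> (fst xe) + snd xe, fst xe)
      \<partial>(design_law p \<Otimes>\<^sub>M ?N))"
    unfolding row_law_def by (subst nn_integral_distr[OF measurable_row_map]) (auto simp: split_beta')
  also have "\<dots> = (\<integral>\<^sup>+x. \<integral>\<^sup>+e. f (linear_predictor p \<beta> x + e, x) \<partial>?N \<partial>design_law p)"
  proof (subst N.nn_integral_fst[symmetric])
    have "(\<lambda>xe. f (linear_predictor p \<beta> (fst xe) + snd xe, fst xe))
        = f \<circ> (\<lambda>(x, e). (linear_predictor p \<beta> x + e, x))"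
      by (auto simp: fun_eq_iff)
    then show "(\<lambda>xe. f (linear_predictor p \<beta> (fst xe)
        + snd xe, fst xe)) \<in> borel_measurable (design_law p \<Otimes>\<^sub>M ?N)"
      using measurable_comp[OF measurable_row_map f] by simp
  qed simp
  also have "\<dots> = (\<integral>\<^sup>+x. \<integral>\<^sup>+y. f (y, x) * ennreal (normal_density 0 \<sigma> (y - linear_predictor p \<beta> x))
      \<partial>lborel \<partial>design_law p)"
  proof (rule nn_integral_cong)
    fix x assume "x \<in> space (design_law p)"
    then have x: "x \<in> space (Pi\<^sub>M {..<p} (\<lambda>_. borel))" by (simp add: space_PiM)
    have [measurable]: "(\<lambda>y. f (y, x)) \<in> borel_measurable borel"
      using x by measurable
    have "(\<integral>\<^sup>+e. f (linear_predictor p \<beta> x + e, x) \<partial>?N)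
        = (\<integral>\<^sup>+e. ennreal (normal_density 0 \<sigma> e) * f (linear_predictor p \<beta> x + e, x) \<partial>lborel)"
      by (rule nn_integral_density) measurable
    also have "\<dots> = (\<integral>\<^sup>+y. f (y, x) * ennreal (normal_density 0 \<sigma> (y - linear_predictor p \<beta> x)) \<partial>lborel)"
      by (subst nn_integral_real_affine[where c=1 and t="linear_predictor p \<beta> x"
          and f="\<lambda>y. f (y, x) * ennreal (normal_density 0 \<sigma> (y - linear_predictor p \<beta> x))"])
        (auto simp: mult.commute)
    finally show "(\<integral>\<^sup>+e. f (linear_predictor p \<beta> x + e, x) \<partial>?N)
      = (\<integral>\<^sup>+y. f (y, x) * ennreal (normal_density 0 \<sigma> (y - linear_predictor p \<beta> x)) \<partial>lborel)" .
  qed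
  finally show ?thesis .
qed

text \<open>
  All design rows and all errors are drawn first and combined afterwards; as the \<open>i\<close>-th observation uses
  only the \<open>i\<close>-th row and the \<open>i\<close>-th error, the observations are independent and identically distributed.
  By \<open>PiM_eqI\<close> it suffices to compare rectangles, on which Fubini's theorem splits the integral into a
  product over the observations.
\<close>

lemma data_law_eq_PiM_row_law:
  assumes \<beta>: "\<beta> \<in> carrier_vec p" and \<sigma>: "\<sigma> > 0"
  shows "data_law n p (\<beta>, 1\<^sub>m p, \<sigma>) = Pi\<^sub>M {..<n} (\<lambda>_. row_law p \<beta> \<sigma>)"
proof -
  let ?N = "density lborel (normal_density 0 \<sigma>)"
  let ?X = "Pi\<^sub>M {..<n} (\<lambda>_. design_law p)" and ?E = "Pi\<^sub>M {..<n} (\<lambda>_. ?N)"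
  let ?T = "\<lambda>(x, e). (linear_predictor p \<beta> x + e, x)"
  have psN: "prob_space ?N" using \<sigma> by (rule prob_space_normal_density)
  interpret N: prob_space ?N by (rule psN)
  interpret E: prob_space ?E by (intro prob_space_PiM psN)
  interpret PN: product_sigma_finite "\<lambda>_::nat. ?N"
    by (simp add: product_sigma_finite_def prob_space_imp_sigma_finite[OF psN])
  interpret PX: product_sigma_finite "\<lambda>_::nat. design_law p"
    by (simp add: product_sigma_finite_def prob_space_imp_sigma_finite[OF prob_space_design_law])
  have "1 \<cdot>\<^sub>m (1\<^sub>m p :: real mat) = 1\<^sub>m p" by (intro eq_matI) auto
  then have "mat_inv (1\<^sub>m p) = 1\<^sup>2 \<cdot>\<^sub>m 1\<^sub>m p"
    using mat_inverse_scaled_one[of 1 p] by simp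
  then have "mvn p (mat_inv (1\<^sub>m p)) = design_law p"
    using mvn_scaled_identity[of 1 p] by simp
  moreover have obs: "observe n p \<beta> (X, \<epsilon>) = (\<lambda>i\<in>{..<n}. ?T (X i, \<epsilon> i))" for X \<epsilon>
    using \<beta> by (auto simp: observe_def linear_predictor_def scalar_prod_def fun_eq_iff atLeast0LessThan)
  ultimately have law: "data_law n p (\<beta>, 1\<^sub>m p, \<sigma>)
      = distr (?X \<Otimes>\<^sub>M ?E) (data_space n p) (\<lambda>(X, \<epsilon>). \<lambda>i\<in>{..<n}. ?T (X i, \<epsilon> i))"
    using \<sigma> by (auto simp: mvn_scaled_identity fun_eq_iff intro!: distr_cong)
  have meas: "(\<lambda>(X, \<epsilon>). \<lambda>i\<in>{..<n}. ?T (X i, \<epsilon> i)) \<in> ?X \<Otimes>\<^sub>M ?E \<rightarrow>\<^sub>M data_space n p"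
    unfolding data_space_def split_beta'
  proof (rule measurable_restrict)
    fix i assume i: "i \<in> {..<n}"
    have "(\<lambda>w. (fst w i, snd w i)) \<in> ?X \<Otimes>\<^sub>M ?E \<rightarrow>\<^sub>M design_law p \<Otimes>\<^sub>M ?N"
      using i by measurable
    from measurable_compose[OF this measurable_row_map]
    show "(\<lambda>w. (linear_predictor p \<beta> (fst (fst w i, snd w i))
        + snd (fst w i, snd w i), fst (fst w i, snd w i)))
        \<in> ?X \<Otimes>\<^sub>M ?E \<rightarrow>\<^sub>M row_space p"
      by (simp add: split_beta')
  qed
  show ?thesis unfolding law
  proof (rule product_sigma_finite.PiM_eqI)
    show "product_sigma_finite (\<lambda>_::nat. row_law p \<beta> \<sigma>)"
      by (simp add: product_sigma_finite_def prob_space_imp_sigma_finite[OF prob_space_row_law[OF \<sigma>]])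
    show "sets (distr (?X \<Otimes>\<^sub>M ?E) (data_space n p) (\<lambda>(X, \<epsilon>). \<lambda>i\<in>{..<n}. ?T (X i, \<epsilon> i)))
        = sets (Pi\<^sub>M {..<n} (\<lambda>_. row_law p \<beta> \<sigma>))"
      by (auto simp: data_space_def sets_row_law intro!: sets_PiM_cong)
    fix A :: "nat \<Rightarrow> _" assume "\<And>i. i \<in> {..<n} \<Longrightarrow> A i \<in> sets (row_law p \<beta> \<sigma>)"
    then have A: "\<And>i. i < n \<Longrightarrow> A i \<in> sets (row_space p)" by (simp add: sets_row_law)
    then have PA: "Pi\<^sub>E {..<n} A \<in> sets (data_space n p)"
      unfolding data_space_def by (intro sets_PiM_I_finite) auto
    have mA: "(\<lambda>xe. indicator (A i) (?T xe)) \<in> borel_measurable (design_law p \<Otimes>\<^sub>M ?N)" if "i < n" for i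
      using measurable_compose[OF measurable_row_map borel_measurable_indicator[OF A[OF that]]] .
    have "emeasure (distr (?X \<Otimes>\<^sub>M ?E) (data_space n p) (\<lambda>(X, \<epsilon>). \<lambda>i\<in>{..<n}. ?T (X i, \<epsilon> i))) (Pi\<^sub>E {..<n} A)
        = (\<integral>\<^sup>+w. indicator (Pi\<^sub>E {..<n} A) ((\<lambda>(X, \<epsilon>). \<lambda>i\<in>{..<n}. ?T (X i, \<epsilon> i)) w) \<partial>(?X \<Otimes>\<^sub>M ?E))"
      using PA by (subst nn_integral_distr[OF meas, symmetric]) (auto simp: nn_integral_indicator)
    also have "\<dots> = (\<integral>\<^sup>+w. (\<Prod>i<n. indicator (A i) (?T (fst w i, snd w i))) \<partial>(?X \<Otimes>\<^sub>M ?E))"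
      by (intro nn_integral_cong) (auto simp: indicator_def PiE_iff Pi_iff prod_zero_iff split: if_splits)
    also have "\<dots> = (\<integral>\<^sup>+X. \<integral>\<^sup>+\<epsilon>. (\<Prod>i<n. indicator (A i) (?T (X i, \<epsilon> i))) \<partial>?E \<partial>?X)"
    proof (subst E.nn_integral_fst[symmetric])
      have "(\<lambda>w. indicator (A i) (?T (fst w i, snd w i)) :: ennreal) \<in> borel_measurable (?X \<Otimes>\<^sub>M ?E)"
          if "i < n" for i
      proof -
        have i: "i \<in> {..<n}" using that by simp
        have "(\<lambda>w. (fst w i, snd w i)) \<in> ?X \<Otimes>\<^sub>M ?E \<rightarrow>\<^sub>M design_law p \<Otimes>\<^sub>M ?N"
          using i by measurable
        from measurable_compose[OF this mA[OF that]] show ?thesis .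
      qed
      then show "(\<lambda>w. (\<Prod>i<n. indicator (A i) (?T (fst w i, snd w i))) :: ennreal) \<in> borel_measurable (?X
          \<Otimes>\<^sub>M ?E)"
        by (intro borel_measurable_prod_ennreal) auto
    qed simp
    also have "\<dots> = (\<integral>\<^sup>+X. (\<Prod>i<n. \<integral>\<^sup>+e. indicator (A i) (?T (X i, e)) \<partial>?N) \<partial>?X)"
    proof (intro nn_integral_cong PN.product_nn_integral_prod)
      fix X i assume "X \<in> space ?X" "i \<in> {..<n}"
      then have "X i \<in> space (design_law p)" "i < n" by (auto simp: space_PiM)
      then show "(\<lambda>e. indicator (A i) (?T (X i, e))) \<in> borel_measurable ?N"
        using measurable_compose[OF measurable_Pair1' mA] by blast
    qed simp
    also have "\<dots> = (\<Prod>i<n. \<integral>\<^sup>+x. \<integral>\<^sup>+e. indicator (A i) (?T (x, e)) \<partial>?N \<partial>design_law p)"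
      using mA by (intro PX.product_nn_integral_prod N.borel_measurable_nn_integral) (auto simp: split_beta')
    also have "\<dots> = (\<Prod>i<n. emeasure (row_law p \<beta> \<sigma>) (A i))"
    proof (rule prod.cong[OF refl])
      fix i assume "i \<in> {..<n}"
      then have i: "i < n" by simp
      have "(\<integral>\<^sup>+x. \<integral>\<^sup>+e. indicator (A i) (?T (x, e)) \<partial>?N \<partial>design_law p)
          = (\<integral>\<^sup>+xe. indicator (A i) (?T xe) \<partial>(design_law p \<Otimes>\<^sub>M ?N))"
        using N.nn_integral_fst[OF mA[OF i]] by simp
      also have "\<dots> = (\<integral>\<^sup>+z. indicator (A i) z \<partial>row_law p \<beta> \<sigma>)"
        unfolding row_law_def using A[OF i] by (subst nn_integral_distr[OF measurable_row_map]) auto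
      also have "\<dots> = emeasure (row_law p \<beta> \<sigma>) (A i)"
        using A[OF i] by (simp add: sets_row_law)
      finally show "(\<integral>\<^sup>+x. \<integral>\<^sup>+e. indicator (A i) (?T (x, e)) \<partial>?N \<partial>design_law p)
          = emeasure (row_law p \<beta> \<sigma>) (A i)" .
    qed
    finally show "emeasure (distr (?X \<Otimes>\<^sub>M ?E) (data_space n p) (\<lambda>(X, \<epsilon>). \<lambda>i\<in>{..<n}. ?T (X i, \<epsilon> i))) (Pi\<^sub>E
        {..<n} A)
      = (\<Prod>i<n. emeasure (row_law p \<beta> \<sigma>) (A i))" .
  qed simp
qed

text \<open>
  From here on the law of the data is used only through its product form.
\<close>

declare data_law.simps[simp del]

section \<open>Likelihood ratios of sparse perturbations\<close>

text \<open>
  The likelihood ratio of \<open>(\<beta>', \<tau>)\<close> to \<open>(\<beta>, s)\<close> for one observation, with noise variances \<open>\<tau>\<close> and \<open>s\<close>; the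
  law of the covariates is common to both and cancels.
\<close>

definition row_ratio :: "nat \<Rightarrow> real vec \<Rightarrow> real \<Rightarrow> real vec \<Rightarrow> real \<Rightarrow> real \<times> (nat \<Rightarrow> real) \<Rightarrow> real" where
  "row_ratio p \<beta> s \<beta>' \<tau> z =
     gaussian_density \<tau> (fst z - linear_predictor p \<beta>' (snd z)) / gaussian_density s (fst z
         - linear_predictor p \<beta> (snd z))"

lemma borel_measurable_row_ratio[measurable]: "row_ratio p \<beta> s \<beta>' \<tau> \<in> borel_measurable (row_space p)"
  unfolding row_ratio_def[abs_def] by measurable

lemma row_ratio_nonneg: "row_ratio p \<beta> s \<beta>' \<tau> z \<ge> 0"
  by (simp add: row_ratio_def)

lemma row_law_eq_density:
  assumes s: "s > 0" and \<tau>: "\<tau> > 0"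
  shows "row_law p \<beta>' (sqrt \<tau>) = density (row_law p \<beta> (sqrt s)) (\<lambda>z. ennreal (row_ratio p \<beta> s \<beta>' \<tau> z))"
proof (rule measure_eqI)
  show "sets (row_law p \<beta>' (sqrt \<tau>)) = sets (density (row_law p \<beta> (sqrt s)) (\<lambda>z. ennreal (row_ratio p \<beta> s
      \<beta>' \<tau> z)))"
    by (simp add: sets_row_law)
  fix A assume "A \<in> sets (row_law p \<beta>' (sqrt \<tau>))"
  then have A[measurable]: "A \<in> sets (row_space p)" by (simp add: sets_row_law)
  have s': "sqrt s > 0" "sqrt \<tau> > 0" using s \<tau> by auto
  have "emeasure (row_law p \<beta>' (sqrt \<tau>)) A = (\<integral>\<^sup>+z. indicator A z \<partial>row_law p \<beta>' (sqrt \<tau>))"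
    using A by (simp add: sets_row_law)
  also have "\<dots> = (\<integral>\<^sup>+x. \<integral>\<^sup>+y. indicator A (y, x) * ennreal (gaussian_density \<tau> (y
      - linear_predictor p \<beta>' x)) \<partial>lborel \<partial>design_law p)"
    by (rule nn_integral_row_law[OF s'(2)]) measurable
  also have "\<dots> = (\<integral>\<^sup>+x. \<integral>\<^sup>+y. (ennreal (row_ratio p \<beta> s \<beta>' \<tau> (y, x)) * indicator A (y, x))
      * ennreal (gaussian_density s (y - linear_predictor p \<beta> x)) \<partial>lborel \<partial>design_law p)"
  proof (intro nn_integral_cong)
    fix x y
    have "gaussian_density s (y - linear_predictor p \<beta> x) > 0"
      using s by (intro normal_density_pos) auto
    then have "ennreal (gaussian_density \<tau> (y - linear_predictor p \<beta>' x))
       = ennreal (row_ratio p \<beta> s \<beta>' \<tau> (y, x)) * ennreal (gaussian_density s (y - linear_predictor p \<beta> x))"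
      by (subst ennreal_mult[symmetric]) (auto simp: row_ratio_def)
    then show "indicator A (y, x) * ennreal (gaussian_density \<tau> (y - linear_predictor p \<beta>' x))
      = (ennreal (row_ratio p \<beta> s \<beta>' \<tau> (y, x)) * indicator A (y, x)) * ennreal (gaussian_density s (y
          - linear_predictor p \<beta> x))"
      by (simp only: mult_ac)
  qed
  also have "\<dots> = (\<integral>\<^sup>+z. ennreal (row_ratio p \<beta> s \<beta>' \<tau> z) * indicator A z \<partial>row_law p \<beta> (sqrt s))"
    by (rule nn_integral_row_law[OF s'(1), symmetric]) measurable
  also have "\<dots> = emeasure (density (row_law p \<beta> (sqrt s)) (\<lambda>z. ennreal (row_ratio p \<beta> s \<beta>' \<tau> z))) A"
    by (rule emeasure_density[symmetric]) (auto simp: sets_row_law)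
  finally show "emeasure (row_law p \<beta>' (sqrt \<tau>)) A
    = emeasure (density (row_law p \<beta> (sqrt s)) (\<lambda>z. ennreal (row_ratio p \<beta> s \<beta>' \<tau> z))) A" .
qed

definition add_spikes :: "nat \<Rightarrow> real vec \<Rightarrow> real \<Rightarrow> nat set \<Rightarrow> real vec" where
  "add_spikes p \<beta> r A = vec p (\<lambda>j. \<beta> $ j + (if j \<in> A then r else 0))"

lemma add_spikes_carrier[simp]: "add_spikes p \<beta> r A \<in> carrier_vec p"
  by (simp add: add_spikes_def)

lemma linear_predictor_add_spikes:
  assumes "A \<subseteq> {..<p}"
  shows "linear_predictor p (add_spikes p \<beta> r A) x = linear_predictor p \<beta> x + r * sum x A"
proof -
  have "linear_predictor p (add_spikes p \<beta> r A) x = linear_predictor p \<beta> x + (\<Sum>j<p.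
      if j \<in> A then x j * r else 0)"
    unfolding linear_predictor_def sum.distrib[symmetric]
    by (intro sum.cong) (auto simp: add_spikes_def algebra_simps)
  also have "(\<Sum>j<p. if j \<in> A then x j * r else 0) = r * sum x A"
    using assms by (simp add: sum.If_cases Int_absorb1 sum_distrib_left mult.commute)
  finally show ?thesis .
qed

lemma sum_add_spikes:
  fixes r :: real
  assumes "A \<subseteq> {..<p}"
  shows "(\<Sum>j<p. add_spikes p \<beta> r A $ j) = (\<Sum>j<p. \<beta> $ j) + card A * r"
  using linear_predictor_add_spikes[OF assms, of \<beta> r "\<lambda>_. 1"] by (simp add: linear_predictor_def)

text \<open>
  An overlap of \<open>A\<close> with the support of \<open>\<beta>\<close> only lowers the count, so the sparsity of a perturbed
  parameter is controlled by the size of \<open>A\<close> alone, wherever \<open>\<beta>\<close> is supported.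
\<close>

lemma norm0_add_spikes:
  assumes "A \<subseteq> {..<p}" "\<beta> \<in> carrier_vec p"
  shows "norm0 (add_spikes p \<beta> r A) \<le> norm0 \<beta> + card A"
proof -
  have "{i. i < dim_vec (add_spikes p \<beta> r A) \<and> add_spikes p \<beta> r A $ i \<noteq> 0} \<subseteq> {i. i < dim_vec \<beta> \<and> \<beta> $ i \<noteq>
      0} \<union> A"
    using assms(2) by (auto simp: add_spikes_def)
  then have "norm0 (add_spikes p \<beta> r A) \<le> card ({i. i < dim_vec \<beta> \<and> \<beta> $ i \<noteq> 0} \<union> A)"
    unfolding norm0_def using finite_subset[OF assms(1)] by (intro card_mono) auto
  also have "\<dots> \<le> norm0 \<beta> + card A" unfolding norm0_def by (rule card_Un_le)
  finally show ?thesis .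
qed

text \<open>
  Translating the response by the linear predictor of \<open>\<beta>\<close> reduces the claim to \<open>row_kernel_integral\<close>.
\<close>

lemma row_ratio_second_moment:
  fixes r s \<tau> :: real and m :: nat
  assumes A: "A \<subseteq> {..<p}" "card A = m" and B: "B \<subseteq> {..<p}" "card B = m"
    and r: "r > 0" and m: "m * r\<^sup>2 < s" and \<tau>: "\<tau> = s - m * r\<^sup>2"
  shows "(\<integral>\<^sup>+z. ennreal (row_ratio p \<beta> s (add_spikes p \<beta> r A) \<tau> z)
      * ennreal (row_ratio p \<beta> s (add_spikes p \<beta> r B) \<tau> z)
      \<partial>row_law p \<beta> (sqrt s)) = ennreal (1 / (1 - card (A \<inter> B) * r\<^sup>2 / s))"
proof -
  have "0 \<le> m * r\<^sup>2" by simp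
  with m have s: "s > 0" by linarith
  let ?lr = "\<lambda>A. row_ratio p \<beta> s (add_spikes p \<beta> r A) \<tau>"
  have "(\<integral>\<^sup>+z. ennreal (?lr A z) * ennreal (?lr B z) \<partial>row_law p \<beta> (sqrt s))
     = (\<integral>\<^sup>+x. \<integral>\<^sup>+y. ennreal (?lr A (y, x)) * ennreal (?lr B (y, x)) * ennreal (gaussian_density s (y
         - linear_predictor p \<beta> x)) \<partial>lborel \<partial>design_law p)"
    using s by (intro nn_integral_row_law) auto
  also have "\<dots> = (\<integral>\<^sup>+x. \<integral>\<^sup>+y. ennreal (gaussian_density \<tau> (y - r * sum x A) * gaussian_density \<tau> (y
      - r * sum x B) / gaussian_density s y)
      \<partial>lborel \<partial>design_law p)"
  proof (rule nn_integral_cong)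
    fix x :: "nat \<Rightarrow> real"
    let ?k = "\<lambda>y. ennreal (gaussian_density \<tau> (y - r * sum x A) * gaussian_density \<tau> (y
        - r * sum x B) / gaussian_density s y)"
    let ?c = "linear_predictor p \<beta> x"
    have eq: "ennreal (?lr A (y, x)) * ennreal (?lr B (y, x)) * ennreal (gaussian_density s (y - ?c))
        = ?k (- ?c + 1 * y)" for y
    proof -
      have pos: "gaussian_density s (y - ?c) > 0" using s by (intro normal_density_pos) auto
      have "ennreal (?lr A (y, x)) * ennreal (?lr B (y, x)) * ennreal (gaussian_density s (y - ?c))
          = ennreal (?lr A (y, x) * ?lr B (y, x) * gaussian_density s (y - ?c))"
        by (simp add: ennreal_mult row_ratio_nonneg)
      also have "?lr A (y, x) * ?lr B (y, x) * gaussian_density s (y - ?c)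
         = gaussian_density \<tau> (y - ?c - r * sum x A) * gaussian_density \<tau> (y - ?c
             - r * sum x B) / gaussian_density s (y - ?c)"
        using pos by (simp add: row_ratio_def linear_predictor_add_spikes[OF A(1)]
            linear_predictor_add_spikes[OF B(1)] diff_diff_eq)
      finally show ?thesis by simp
    qed
    show "(\<integral>\<^sup>+y. ennreal (?lr A (y, x)) * ennreal (?lr B (y, x)) * ennreal (gaussian_density s (y - ?c))
        \<partial>lborel) = (\<integral>\<^sup>+y. ?k y \<partial>lborel)"
      unfolding eq by (subst (2) nn_integral_real_affine[where c=1 and t="- ?c"]) auto
  qed
  also have "\<dots> = ennreal (1 / (1 - card (A \<inter> B) * r\<^sup>2 / s))"
    unfolding \<tau> using A B r m by (intro row_kernel_integral) auto
  finally show ?thesis .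
qed

text \<open>
  The lower bound for fixed dimensions. The hypothesis \<open>chi\<close> bounds the second moment of the mixture over
  supports with one coordinate in each of \<open>m\<close> blocks of length \<open>q\<close>; the hypothesis \<open>small\<close> keeps the
  reduced noise variance positive and turns \<open>1 / (1 - x)\<close> into the bound \<open>exp (2 x)\<close>.
\<close>

lemma expected_length_lower_bound:
  fixes r \<sigma> t \<alpha> :: real and m q n p :: nat
  assumes \<beta>: "\<beta> \<in> carrier_vec p" and \<sigma>: "\<sigma> > 0" and r: "r > 0" and t: "t > 0"
    and q: "q > 0" "m * q \<le> p"
    and small: "2 * (m * r\<^sup>2) \<le> \<sigma>\<^sup>2"
    and chi: "exp (m * (exp (2 * n * r\<^sup>2 / \<sigma>\<^sup>2) - 1) / q) \<le> 1 + t\<^sup>2"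
    and meas: "l \<in> borel_measurable (data_space n p)" "u \<in> borel_measurable (data_space n p)"
    and lu: "\<And>z. z \<in> space (data_space n p) \<Longrightarrow> l z \<le> u z"
    and cov0: "measure (data_law n p (\<beta>, 1\<^sub>m p, \<sigma>))
      {z \<in> space (data_space n p). l z \<le> (\<Sum>j<p. \<beta> $ j) \<and> (\<Sum>j<p. \<beta> $ j) \<le> u z} \<ge> 1 - \<alpha>"
    and cov1: "\<And>A. A \<subseteq> {..<p} \<Longrightarrow> card A = m \<Longrightarrow>
      measure (data_law n p (add_spikes p \<beta> r A, 1\<^sub>m p, sqrt (\<sigma>\<^sup>2 - m * r\<^sup>2)))
      {z \<in> space (data_space n p). l z \<le> (\<Sum>j<p. \<beta> $ j) + m * r \<and> (\<Sum>j<p. \<beta> $ j) + m * r \<le> u z} \<ge> 1 - \<alpha>"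
  shows "ennreal (m * r * (1 - 2 * \<alpha> - t)) \<le> expected_length n p (\<beta>, 1\<^sub>m p, \<sigma>) (l, u)"
proof -
  define s where "s = \<sigma>\<^sup>2"
  define \<tau> where "\<tau> = s - m * r\<^sup>2"
  define P where "P = Pi\<^sub>M {..<n} (\<lambda>_. row_law p \<beta> (sqrt s))"
  define F where "F = Pi\<^sub>E {..<m} (\<lambda>_. {..<q})"
  \<comment> \<open>A choice function \<open>f\<close> selects the coordinate with offset \<open>f a\<close> from the block that starts at \<open>a * q\<close>.\<close>
  define S where "S f = (\<lambda>a. a * q + f a) ` {..<m}" for f :: "nat \<Rightarrow> nat"
  define L where "L f z = (\<Prod>i<n. row_ratio p \<beta> s (add_spikes p \<beta> r (S f)) \<tau> (z i))" for f z
  let ?T = "\<Sum>j<p. \<beta> $ j"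
  let ?B = "{z \<in> space (data_space n p). l z \<le> ?T + m * r \<and> ?T + m * r \<le> u z}"
  have s: "s > 0" using \<sigma> by (simp add: s_def)
  have mr: "m * r\<^sup>2 < s" using small s unfolding s_def by linarith
  then have \<tau>: "\<tau> > 0" by (simp add: \<tau>_def)
  have sq: "sqrt s > 0" "sqrt \<tau> > 0" using s \<tau> by auto
  have P: "data_law n p (\<beta>, 1\<^sub>m p, \<sigma>) = P"
    using \<sigma> by (simp add: data_law_eq_PiM_row_law[OF \<beta>] P_def s_def)
  have setsP[measurable_cong]: "sets P = sets (data_space n p)"
    unfolding P_def data_space_def by (intro sets_PiM_cong) (auto simp: sets_row_law)
  then have spaceP: "space P = space (data_space n p)" by (rule sets_eq_imp_space_eq)
  interpret P: prob_space P
    unfolding P_def by (intro prob_space_PiM prob_space_row_law sq)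
  interpret R: product_sigma_finite "\<lambda>_::nat. row_law p \<beta> (sqrt s)"
    by (simp add: product_sigma_finite_def prob_space_imp_sigma_finite[OF prob_space_row_law[OF sq(1)]])
  have Sinj: "a = a' \<and> b = b'" if "a * q + b = a' * q + b'" "b < q" "b' < q" for a a' b b' :: nat
  proof -
    have "(a * q + b) div q = a" "(a' * q + b') div q = a'" "(a * q + b) mod q = b" "(a' * q + b') mod q = b'"
      using that(2,3) by simp_all
    then show ?thesis using that(1) by metis
  qed
  have Fb: "f a < q" if "f \<in> F" "a < m" for f a using that by (auto simp: F_def)
  have S: "S f \<subseteq> {..<p}" "card (S f) = m" if f: "f \<in> F" for f
  proof -
    have "a * q + f a < p" if "a < m" for a
    proof -
      have "a * q + f a < Suc a * q" using Fb[OF f that] by simp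
      also have "\<dots> \<le> m * q" using that by (intro mult_right_mono) auto
      finally show ?thesis using q by simp
    qed
    then show "S f \<subseteq> {..<p}" by (auto simp: S_def)
    have "inj_on (\<lambda>a. a * q + f a) {..<m}"
      using Sinj Fb[OF f] by (intro inj_onI) blast
    then show "card (S f) = m" by (simp add: S_def card_image)
  qed
  \<comment> \<open>Different blocks are disjoint, so supports meet exactly where the choice functions agree.\<close>
  have Scap: "card (S f \<inter> S g) = card {a. a < m \<and> f a = g a}" if fg: "f \<in> F" "g \<in> F" for f g
  proof -
    have "S f \<inter> S g = (\<lambda>a. a * q + f a) ` {a. a < m \<and> f a = g a}"
    proof (intro equalityI subsetI)
      fix j assume "j \<in> S f \<inter> S g"
      then obtain a a' where "a < m" "a' < m" "j = a * q + f a" "j = a' * q + g a'" by (auto simp: S_def)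
      with Sinj[of a "f a" a' "g a'"] Fb fg have "a < m" "f a = g a" "j = a * q + f a" by auto
      then show "j \<in> (\<lambda>a. a * q + f a) ` {a. a < m \<and> f a = g a}" by blast
    next
      fix j assume "j \<in> (\<lambda>a. a * q + f a) ` {a. a < m \<and> f a = g a}"
      then obtain a where "a < m" "j = a * q + f a" "j = a * q + g a" by auto
      then show "j \<in> S f \<inter> S g" unfolding S_def by blast
    qed
    moreover have "inj_on (\<lambda>a. a * q + f a) {a. a < m \<and> f a = g a}"
      using Sinj Fb[OF fg(1)] by (intro inj_onI) blast
    ultimately show ?thesis by (simp only: card_image)
  qed
  have Q: "data_law n p (add_spikes p \<beta> r (S f), 1\<^sub>m p, sqrt (\<sigma>\<^sup>2 - m * r\<^sup>2))
      = density P (\<lambda>z. ennreal (L f z))" if "f \<in> F" for f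
  proof -
    let ?d = "\<lambda>z. ennreal (row_ratio p \<beta> s (add_spikes p \<beta> r (S f)) \<tau> z)"
    have Q1: "row_law p (add_spikes p \<beta> r (S f)) (sqrt \<tau>) = density (row_law p \<beta> (sqrt s)) ?d"
      by (rule row_law_eq_density[OF s \<tau>])
    have "data_law n p (add_spikes p \<beta> r (S f), 1\<^sub>m p, sqrt (\<sigma>\<^sup>2 - m * r\<^sup>2))
        = Pi\<^sub>M {..<n} (\<lambda>_. row_law p (add_spikes p \<beta> r (S f)) (sqrt \<tau>))"
      using sq by (simp add: data_law_eq_PiM_row_law \<tau>_def s_def)
    also have "\<dots> = Pi\<^sub>M {..<n} (\<lambda>_. density (row_law p \<beta> (sqrt s)) ?d)"
      by (simp only: Q1)
    also have "\<dots> = density P (\<lambda>z. \<Prod>i<n. ?d (z i))"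
      unfolding P_def
    proof (rule PiM_density[symmetric])
      show "product_sigma_finite (\<lambda>_::nat. density (row_law p \<beta> (sqrt s)) ?d)"
        unfolding Q1[symmetric]
        by (simp add: product_sigma_finite_def prob_space_imp_sigma_finite[OF prob_space_row_law[OF sq(2)]])
    qed (auto intro: R.product_sigma_finite_axioms)
    also have "(\<lambda>z. \<Prod>i<n. ?d (z i)) = (\<lambda>z. ennreal (L f z))"
      by (simp add: L_def prod_ennreal row_ratio_nonneg)
    finally show ?thesis .
  qed
  have L0: "L f z \<ge> 0" for f z by (simp add: L_def prod_nonneg row_ratio_nonneg)
  have Lm[measurable]: "L f \<in> borel_measurable P" for f
    unfolding L_def[abs_def] P_def by measurable
  have F: "finite F" "F \<noteq> {}" using q by (auto simp: F_def PiE_eq_empty_iff intro: finite_PiE)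
  have second: "(\<integral>\<^sup>+z. ennreal (L f z * L g z) \<partial>P) \<le> ennreal (exp (2 * n * r\<^sup>2 / \<sigma>\<^sup>2
      * card {a. a < m \<and> f a = g a}))"
    if fg: "f \<in> F" "g \<in> F" for f g
  proof -
    let ?d = "\<lambda>f z. ennreal (row_ratio p \<beta> s (add_spikes p \<beta> r (S f)) \<tau> z)"
    define J where "J = card {a. a < m \<and> f a = g a}"
    define x where "x = J * r\<^sup>2 / s"
    have "J \<le> card {..<m}" unfolding J_def by (intro card_mono) auto
    then have "2 * (J * r\<^sup>2) \<le> 2 * (m * r\<^sup>2)" by (intro mult_left_mono mult_right_mono) auto
    then have x: "0 \<le> x" "x \<le> 1/2" using small s by (auto simp: x_def s_def field_simps)
    have "(\<integral>\<^sup>+z. ennreal (L f z * L g z) \<partial>P) = (\<integral>\<^sup>+z. (\<Prod>i<n. ?d f (z i) * ?d g (z i)) \<partial>P)"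
      by (intro nn_integral_cong) (simp add: L_def prod_ennreal row_ratio_nonneg prod_nonneg prod.distrib
          ennreal_mult)
    also have "\<dots> = (\<Prod>i<n. \<integral>\<^sup>+z. ?d f z * ?d g z \<partial>row_law p \<beta> (sqrt s))"
      unfolding P_def by (intro R.product_nn_integral_prod) auto
    also have "(\<integral>\<^sup>+z. ?d f z * ?d g z \<partial>row_law p \<beta> (sqrt s)) = ennreal (1 / (1 - x))"
      using row_ratio_second_moment[OF S(1)[OF fg(1)] S(2)[OF fg(1)] S(1)[OF fg(2)] S(2)[OF fg(2)] r mr \<tau>_def]
      by (simp add: x_def J_def Scap[OF fg])
    also have "(\<Prod>i<n. ennreal (1 / (1 - x))) = ennreal ((1 / (1 - x)) ^ n)"
      using x by (simp add: ennreal_power)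
    also have "\<dots> \<le> ennreal (exp (2 * x) ^ n)"
    proof (intro ennreal_leI power_mono)
      have "x * (2 * x) \<le> x * 1" using x by (intro mult_left_mono) auto
      then have "1 / (1 - x) \<le> 1 + 2 * x" using x by (simp add: divide_le_eq algebra_simps)
      also have "\<dots> \<le> exp (2 * x)" by (rule exp_ge_add_one_self)
      finally show "1 / (1 - x) \<le> exp (2 * x)" .
    qed (use x in auto)
    also have "exp (2 * x) ^ n = exp (2 * n * r\<^sup>2 / \<sigma>\<^sup>2 * J)"
      by (simp add: exp_of_nat_mult[symmetric] x_def s_def mult_ac)
    finally show ?thesis by (simp add: J_def)
  qed
  have "(\<Sum>f\<in>F. \<Sum>g\<in>F. \<integral>\<^sup>+z. ennreal (L f z * L g z) \<partial>P)
      \<le> (\<Sum>f\<in>F. \<Sum>g\<in>F. ennreal (exp (2 * n * r\<^sup>2 / \<sigma>\<^sup>2 * card {a. a < m \<and> f a = g a})))"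
    by (intro sum_mono second)
  also have "\<dots> = ennreal (\<Sum>f\<in>F. \<Sum>g\<in>F. exp (2 * n * r\<^sup>2 / \<sigma>\<^sup>2 * card {a. a < m \<and> f a = g a}))"
    by (simp add: sum_nonneg)
  also have "\<dots> \<le> ennreal ((1 + t\<^sup>2) * (real (card F))\<^sup>2)"
    using order_trans[OF sum_exp_agreements[OF q(1)] mult_right_mono[OF chi]]
    unfolding F_def by (intro ennreal_leI) auto
  finally have "(\<Sum>f\<in>F. measure (density P (L f)) ?B) \<le> card F * (P.prob ?B + t)"
    using F t L0 meas spaceP Q sq
    by (intro P.chi_square_mixture_bound)
       (auto simp: Q[symmetric] data_law_eq_PiM_row_law \<tau>_def[symmetric] s_def[symmetric] intro!:
           prob_space_PiM prob_space_row_law)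
  moreover have "card F * (1 - \<alpha>) \<le> (\<Sum>f\<in>F. measure (density P (L f)) ?B)"
  proof -
    have "1 - \<alpha> \<le> measure (density P (L f)) ?B" if "f \<in> F" for f
      using cov1[OF S[OF that]] Q[OF that] by simp
    then show ?thesis by (rule sum_bounded_below)
  qed
  ultimately have "card F * (1 - \<alpha>) \<le> card F * (P.prob ?B + t)" by linarith
  then have "1 - \<alpha> \<le> P.prob ?B + t"
    using F by (simp add: card_gt_0_iff)
  then have covB: "P.prob {z \<in> space P. l z \<le> ?T + m * r \<and> ?T + m * r \<le> u z} \<ge> 1 - \<alpha> - t"
    by (simp add: spaceP)
  have covA: "P.prob {z \<in> space P. l z \<le> ?T \<and> ?T \<le> u z} \<ge> 1 - \<alpha>"
    using cov0 by (simp add: P spaceP)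
  have "ennreal (m * r * ((1 - \<alpha>) + (1 - \<alpha> - t) - 1)) \<le> (\<integral>\<^sup>+z. ennreal (u z - l z) \<partial>P)"
    using r meas lu by (intro P.two_point_coverage_length[OF _ _ _ _ covA covB]) (auto simp: spaceP)
  then show ?thesis by (simp add: expected_length_def P algebra_simps)
qed

section \<open>The lower bound on the expected length\<close>

text \<open>
  The factor \<open>P\<^sup>a - 1\<close> is of order \<open>a ln P\<close>, up to the factor \<open>P\<^sup>a \<le> P\<^sup>d\<close>; the remaining \<open>P\<^sup>-\<^sup>d\<close> absorbs the
  logarithm. The bound is uniform in \<open>P\<close>, so the chi-square distance can be made small by the choice of a
  constant alone, even for small \<open>p\<close>.
\<close>

lemma powr_small_exponent_bound:
  fixes P a d :: real
  assumes P: "P \<ge> 1" and d: "d > 0" and a: "0 \<le> a" "a \<le> d"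
  shows "P powr (- 2 * d) * (P powr a - 1) \<le> a / d"
proof -
  have "P powr a - 1 \<le> a * ln P * P powr a"
  proof -
    have "1 + (- (a * ln P)) \<le> exp (- (a * ln P))" by (rule exp_ge_add_one_self)
    then have "P powr a * (1 - a * ln P) \<le> P powr a * exp (- (a * ln P))"
      by (intro mult_left_mono) auto
    also have "P powr a * exp (- (a * ln P)) = 1"
      using P by (simp add: powr_def flip: exp_add)
    finally show ?thesis by (simp add: algebra_simps)
  qed
  also have "\<dots> \<le> a * ln P * P powr d"
    using P a by (intro mult_left_mono powr_mono) auto
  finally have "P powr (- 2 * d) * (P powr a - 1) \<le> P powr (- 2 * d) * (a * ln P * P powr d)"
    by (intro mult_left_mono) auto
  also have "\<dots> = a * (ln P * P powr (- d))"
    using P by (simp add: mult_ac flip: powr_add)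
  also have "\<dots> \<le> a * (1 / d)"
  proof (intro mult_left_mono)
    have "d * ln P = ln (P powr d)" using P by (simp add: ln_powr)
    also have "\<dots> \<le> P powr d"
      using P ln_le_minus_one[of "P powr d"] by simp
    finally have "d * ln P * P powr (- d) \<le> P powr d * P powr (- d)"
      by (intro mult_right_mono) auto
    then show "ln P * P powr (- d) \<le> 1 / d"
      using d P by (simp add: field_simps flip: powr_add)
  qed (use a in auto)
  finally show ?thesis by simp
qed

theorem corollary2:
  fixes \<alpha> c \<gamma> \<zeta>\<^sub>0 M1 M2 :: real
  assumes "0 < \<alpha>" "\<alpha> < 1/2"
    and "c > 0" "0 \<le> \<gamma>" "\<gamma> < 1/2"
    and "0 < \<zeta>\<^sub>0" "\<zeta>\<^sub>0 < 1"
    and "M1 > 1" "M2 > 0"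
  shows "\<exists>c\<^sub>1>0. \<forall>(n::nat) (p::nat) (k::nat) (k\<^sub>1::nat) (\<beta>::real vec) (\<sigma>::real).
    n \<ge> 1 \<longrightarrow> p \<ge> 1 \<longrightarrow>
    real k \<le> c * min (real p powr \<gamma>) (real n / ln (real p)) \<longrightarrow>
    real k\<^sub>1 \<le> (1 - \<zeta>\<^sub>0) * real k - 1 \<longrightarrow>
    (\<beta>, 1\<^sub>m p, \<sigma>) \<in> param_space p M1 M2 k\<^sub>1 \<longrightarrow>
    (INF CI\<in>conf_intervals n p \<alpha> (param_space p M1 M2 k) (\<lambda>b. \<Sum>i<p. b $ i).
        expected_length n p (\<beta>, 1\<^sub>m p, \<sigma>) CI)
      \<ge> ennreal (c\<^sub>1 * real k * sqrt (ln (real p) / real n) * \<sigma>)"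
proof -
  define t where "t = (1 - 2 * \<alpha>) / 2"
  define d where "d = (1 - 2 * \<gamma>) / 2"
  \<comment> \<open>The three bounds on \<open>h\<close> serve, in this order, the uniform estimate of \<open>powr_small_exponent_bound\<close>, the
    positivity of the reduced noise variance, and the smallness of the chi-square distance.\<close>
  define h where "h = Min {d / 2, 1 / (2 * c), d * ln (1 + t\<^sup>2) / (4 * c\<^sup>2)}"
  define b where "b = min \<zeta>\<^sub>0 (1 / c)"
  have t: "t > 0" using assms by (simp add: t_def)
  have d: "d > 0" using assms by (simp add: d_def)
  have lnt: "ln (1 + t\<^sup>2) > 0" using t by (intro ln_gt_zero) simp
  have h: "h > 0" "h \<le> d / 2" "h \<le> 1 / (2 * c)" "h \<le> d * ln (1 + t\<^sup>2) / (4 * c\<^sup>2)"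
    using assms d lnt by (auto simp: h_def)
  have b: "b > 0" using assms by (simp add: b_def)
  show ?thesis
  proof (intro exI[of _ "b * sqrt h * t"] conjI allI impI)
    show "b * sqrt h * t > 0" using b h t by simp
    fix n p k k\<^sub>1 :: nat and \<beta> :: "real vec" and \<sigma> :: real
    assume n: "n \<ge> 1" and p: "p \<ge> 1"
      and k: "real k \<le> c * min (real p powr \<gamma>) (real n / ln (real p))"
      and k1: "real k\<^sub>1 \<le> (1 - \<zeta>\<^sub>0) * real k - 1"
      and \<theta>: "(\<beta>, 1\<^sub>m p, \<sigma>) \<in> param_space p M1 M2 k\<^sub>1"
    have \<beta>: "\<beta> \<in> carrier_vec p" "norm0 \<beta> \<le> k\<^sub>1" and \<sigma>: "0 < \<sigma>" "\<sigma> \<le> M2"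
      using \<theta> by (auto simp: param_space_def)
    \<comment> \<open>The bound on \<open>k\<^sub>1\<close> excludes \<open>k = 0\<close>, and therefore \<open>p = 1\<close>, where \<open>n / ln p = 0\<close> by convention.\<close>
    have "k \<noteq> 0" using k1 by (cases "k = 0") auto
    then have k_ge: "real k \<ge> 1" by simp
    have "p \<noteq> 1" using k k_ge by auto
    then have p2: "p \<ge> 2" using p by simp
    have lnp: "ln (real p) > 0" using p2 by simp
    have kp: "real k \<le> c * real p powr \<gamma>" and kn: "real k * ln (real p) \<le> c * n"
    proof -
      have "c * min (real p powr \<gamma>) (real n / ln (real p)) \<le> c * (real n / ln (real p))"
        "c * min (real p powr \<gamma>) (real n / ln (real p)) \<le> c * real p powr \<gamma>"
        using assms(3) by (auto intro!: mult_left_mono simp del: times_divide_eq_right)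
      with k have "real k \<le> c * (real n / ln (real p))" and kp: "real k \<le> c * real p powr \<gamma>"
        by linarith+
      then show "real k * ln (real p) \<le> c * n" using lnp by (simp add: field_simps)
      show "real k \<le> c * real p powr \<gamma>" by (rule kp)
    qed
    \<comment> \<open>The sparsity budget left by \<open>\<beta>\<close> is \<open>k - k\<^sub>1\<close>, at least \<open>\<zeta>\<^sub>0 k\<close>. It can exceed \<open>p\<close> when \<open>c\<close>
      is large and \<open>p\<close> small, hence the minimum; as \<open>k \<le> c p\<close>, this costs only the factor \<open>1 / c\<close> in \<open>b\<close>.\<close>
    define m where "m = min (k - k\<^sub>1) p"
    define q where "q = p div m"
    define r where "r = \<sigma> * sqrt (h * ln (real p) / n)"
    have zk: "\<zeta>\<^sub>0 * real k + 1 \<le> real k - real k\<^sub>1" using k1 by (simp add: algebra_simps)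
    moreover have "0 \<le> \<zeta>\<^sub>0 * real k" using assms by simp
    ultimately have "real k\<^sub>1 + 1 \<le> real k" by linarith
    then have k1k: "k\<^sub>1 < k" by simp
    have m: "m \<ge> 1" "m \<le> k" "m \<le> p" "k\<^sub>1 + m \<le> k"
      using k1k p by (auto simp: m_def)
    have mb: "b * real k \<le> real m"
    proof -
      have "b * real k \<le> real k - real k\<^sub>1"
      proof -
        have "b * real k \<le> \<zeta>\<^sub>0 * real k" by (intro mult_right_mono) (auto simp: b_def)
        with zk show ?thesis by linarith
      qed
      moreover have "b * real k \<le> real p"
      proof -
        have "b * real k \<le> (1 / c) * (c * real p powr \<gamma>)"
          using kp assms by (intro mult_mono) (auto simp: b_def)
        also have "\<dots> = real p powr \<gamma>" using assms by simp
        also have "\<dots> \<le> real p powr 1" using assms p by (intro powr_mono) auto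
        finally show ?thesis using p by simp
      qed
      ultimately show ?thesis using k1k by (simp add: m_def of_nat_diff)
    qed
    have q: "q > 0" "m * q \<le> p" using m by (auto simp: q_def div_greater_zero_iff)
    have qp: "real p \<le> 2 * real m * real q"
    proof -
      have "p = m * q + p mod m" by (simp add: q_def)
      moreover have "p mod m \<le> m" "m \<le> m * q" using m q by (simp_all add: less_imp_le)
      ultimately have "p \<le> 2 * m * q" by linarith
      then have "real p \<le> real (2 * m * q)" by (rule of_nat_mono)
      then show ?thesis by simp
    qed
    have n0: "real n > 0" using n by simp
    have r2: "r\<^sup>2 = \<sigma>\<^sup>2 * (h * ln (real p) / n)"
      using h lnp n0 by (simp add: r_def power_mult_distrib)
    have r: "r > 0" using h lnp n0 \<sigma> by (simp add: r_def)
    \<comment> \<open>By \<open>k ln p \<le> c n\<close> and \<open>h \<le> 1 / (2 c)\<close>.\<close>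
    have small: "2 * (m * r\<^sup>2) \<le> \<sigma>\<^sup>2"
    proof -
      have "2 * (real m * ln (real p)) * h \<le> 2 * (c * n) * (1 / (2 * c))"
      proof (rule mult_mono)
        have "real m * ln (real p) \<le> real k * ln (real p)" using m lnp by (intro mult_right_mono) auto
        then show "2 * (real m * ln (real p)) \<le> 2 * (c * real n)" using kn by linarith
      qed (use h assms in auto)
      also have "\<dots> = n" using assms by simp
      finally have "2 * (real m * ln (real p)) * h / n \<le> 1" using n0 by (simp add: field_simps)
      then have "\<sigma>\<^sup>2 * (2 * (real m * ln (real p)) * h / n) \<le> \<sigma>\<^sup>2 * 1" by (intro mult_left_mono) auto
      then show ?thesis unfolding r2 by (simp add: mult_ac)
    qed
    have chi: "exp (m * (exp (2 * n * r\<^sup>2 / \<sigma>\<^sup>2) - 1) / q) \<le> 1 + t\<^sup>2"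
    proof -
      have "exp (2 * n * r\<^sup>2 / \<sigma>\<^sup>2) = real p powr (2 * h)"
        using \<sigma> n0 p by (simp add: r2 powr_def mult_ac)
      moreover have "real m * (real p powr (2 * h) - 1) / q \<le> ln (1 + t\<^sup>2)"
      proof -
        have pow: "real p powr (2 * h) - 1 \<ge> 0" using p h ge_one_powr_ge_zero[of "real p" "2 * h"] by simp
        have "real m / q \<le> 2 * (real m)\<^sup>2 / p"
          using qp q p m by (simp add: field_simps power2_eq_square)
        also have "\<dots> \<le> 2 * (c * real p powr \<gamma>)\<^sup>2 / p"
          using m kp by (intro divide_right_mono mult_left_mono power_mono) auto
        also have "\<dots> = 2 * c\<^sup>2 * real p powr (- 2 * d)"
        proof -
          have "(real p powr \<gamma>)\<^sup>2 / p = real p powr (\<gamma> + \<gamma>) * real p powr (- 1)"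
            using p by (simp only: power2_eq_square powr_add) (simp add: powr_minus divide_inverse)
          also have "\<dots> = real p powr (- 2 * d)"
            unfolding powr_add[symmetric] by (rule arg_cong[of _ _ "(powr) (real p)"]) (simp add: d_def
                field_simps)
          finally have "(real p powr \<gamma>)\<^sup>2 / p = real p powr (- 2 * d)" .
          moreover have "2 * (c * real p powr \<gamma>)\<^sup>2 / p = 2 * c\<^sup>2 * ((real p powr \<gamma>)\<^sup>2 / p)"
            by (simp add: power_mult_distrib)
          ultimately show ?thesis by (simp only:)
        qed
        finally have "real m / q * (real p powr (2 * h) - 1)
            \<le> 2 * c\<^sup>2 * real p powr (- 2 * d) * (real p powr (2 * h) - 1)"
          using pow by (intro mult_right_mono)
        also have "\<dots> \<le> 2 * c\<^sup>2 * (2 * h / d)"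
          using powr_small_exponent_bound[of "real p" d "2 * h"] p d h
              by (simp only: mult.assoc, intro mult_left_mono) auto
        also have "\<dots> \<le> 2 * c\<^sup>2 * (2 * (d * ln (1 + t\<^sup>2) / (4 * c\<^sup>2)) / d)"
          using h d by (intro mult_left_mono divide_right_mono) auto
        also have "\<dots> = ln (1 + t\<^sup>2)" using assms d by simp
        finally show ?thesis by simp
      qed
      ultimately have "exp (m * (exp (2 * n * r\<^sup>2 / \<sigma>\<^sup>2) - 1) / q) \<le> exp (ln (1 + t\<^sup>2))"
        by simp
      also have "\<dots> = 1 + t\<^sup>2" by (rule exp_ln) (simp add: add_pos_nonneg)
      finally show ?thesis .
    qed
    show "(INF CI\<in>conf_intervals n p \<alpha> (param_space p M1 M2 k) (\<lambda>b. \<Sum>i<p. b $ i).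
        expected_length n p (\<beta>, 1\<^sub>m p, \<sigma>) CI)
      \<ge> ennreal (b * sqrt h * t * real k * sqrt (ln (real p) / real n) * \<sigma>)"
    proof (rule INF_greatest)
      fix CI assume CI: "CI \<in> conf_intervals n p \<alpha> (param_space p M1 M2 k) (\<lambda>b. \<Sum>i<p. b $ i)"
      obtain l u where lu: "CI = (l, u)" by (cases CI)
      let ?cov = "\<lambda>\<theta>. measure (data_law n p \<theta>) {z \<in> space (data_space n p). l z
          \<le> (\<Sum>i<p. fst \<theta> $ i) \<and> (\<Sum>i<p. fst \<theta> $ i) \<le> u z}"
      have cov: "1 - \<alpha> \<le> ?cov \<theta>'" if "\<theta>' \<in> param_space p M1 M2 k" for \<theta>'
      proof -
        have "1 - \<alpha> \<le> (INF \<theta>\<in>param_space p M1 M2 k. ?cov \<theta>)"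
          using CI by (simp add: lu conf_intervals_def)
        also have "\<dots> \<le> ?cov \<theta>'"
          using that by (intro cINF_lower bdd_belowI2[of _ 0]) auto
        finally show ?thesis .
      qed
      have "ennreal (b * sqrt h * t * real k * sqrt (ln (real p) / real n) * \<sigma>)
          \<le> ennreal (m * r * (1 - 2 * \<alpha> - t))"
      proof (rule ennreal_leI)
        have "(b * real k) * (r * t) \<le> real m * (r * t)"
          using mb r t by (intro mult_right_mono) auto
        moreover have "1 - 2 * \<alpha> - t = t" by (simp add: t_def field_simps)
        moreover have "r = \<sigma> * (sqrt h * sqrt (ln (real p) / n))"
          by (simp add: r_def flip: real_sqrt_mult)
        ultimately show "b * sqrt h * t * real k * sqrt (ln (real p) / real n) * \<sigma> \<le> m * r * (1 - 2 * \<alpha> - t)"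
          by (simp add: mult_ac)
      qed
      also have "\<dots> \<le> expected_length n p (\<beta>, 1\<^sub>m p, \<sigma>) (l, u)"
      proof (rule expected_length_lower_bound[OF \<beta>(1) \<sigma>(1) r t q small chi])
        have "(\<beta>, 1\<^sub>m p, \<sigma>) \<in> param_space p M1 M2 k"
          using \<theta> k1k by (auto simp: param_space_def)
        from cov[OF this] show "1 - \<alpha> \<le> measure (data_law n p (\<beta>, 1\<^sub>m p, \<sigma>))
          {z \<in> space (data_space n p). l z \<le> (\<Sum>j<p. \<beta> $ j) \<and> (\<Sum>j<p. \<beta> $ j) \<le> u z}" by simp
      next
        fix A assume A: "A \<subseteq> {..<p}" "card A = m"
        let ?\<tau> = "\<sigma>\<^sup>2 - m * r\<^sup>2"
        have "m * r\<^sup>2 \<ge> 0" by simp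
        moreover have "0 < \<sigma>\<^sup>2" using \<sigma> by simp
        ultimately have "0 < ?\<tau>" "?\<tau> \<le> \<sigma>\<^sup>2" using small by linarith+
        then have "0 < sqrt ?\<tau>" "sqrt ?\<tau> \<le> M2"
          using \<sigma> real_sqrt_le_mono[of ?\<tau> "\<sigma>\<^sup>2"] by auto
        moreover have "norm0 (add_spikes p \<beta> r A) \<le> k"
          using norm0_add_spikes[OF A(1) \<beta>(1), of r] A \<beta> m by linarith
        ultimately have "(add_spikes p \<beta> r A, 1\<^sub>m p, sqrt ?\<tau>) \<in> param_space p M1 M2 k"
          using \<theta> by (auto simp: param_space_def)
        from cov[OF this] show "1 - \<alpha> \<le> measure (data_law n p (add_spikes p \<beta> r A, 1\<^sub>m p, sqrt ?\<tau>))
          {z \<in> space (data_space n p). l z \<le> (\<Sum>j<p. \<beta> $ j) + m * r \<and> (\<Sum>j<p. \<beta> $ j) + m * r \<le> u z}"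
          unfolding fst_conv sum_add_spikes[OF A(1)] A(2) .
      qed (use CI in \<open>auto simp: lu conf_intervals_def\<close>)
      finally show "ennreal (b * sqrt h * t * real k * sqrt (ln (real p) / real n) * \<sigma>)
          \<le> expected_length n p (\<beta>, 1\<^sub>m p, \<sigma>) CI" by (simp add: lu)
    qed
  qed
qed

end
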